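(* Let $\mathcal H$ be an infinite-dimensional separable complex Hilbert space. Let $C,S\in B(\mathcal H)$ be such that $C^*C+S^*S=P$ with $P=P^2$, and let $E\in B(\mathcal H)$ be self-adjoint. Then $$2\,s(SEC^* )\prec_w \mathrm{Spr}^+(PEP\oplus 0_{\mathcal H}).$$ In particular, if $\dim\ker P=\infty$, then $2\,s(SEC^* )\prec_w\mathrm{Spr}^+(PEP)$.
   Context: $\mathbb N=\{1,2,\dots\}$, $\mathbb Z_0=\mathbb Z\setminus\{0\}$. $PEP\oplus 0_{\mathcal H}$ is the block diagonal operator on $\mathcal H\oplus\mathcal H$ with diagonal blocks $PEP$ and the zero operator. Spectral scale: for a bounded self-adjoint operator $A$ on an infinite-dimensional separable complex Hilbert space $\mathcal L$, $\lambda(A)=(\lambda_i(A))_{i\in\mathbb Z_0}$ is defined, for $i\in\mathbb N$, by $$\lambda_i(A)=\inf_{\dim\mathcal S=i-1}\ \sup_{\psi\in\mathcal S^\perp,\|\psi\|=1}\langle A\psi,\psi\rangle,\qquad \lambda_{-i}(A)=\sup_{\dim\mathcal S=i-1}\ \inf_{\psi\in\mathcal S^\perp,\|\psi\|=1}\langle A\psi,\psi\rangle,$$ where $\mathcal S$ ranges over $(i-1)$-dimensional subspaces of $\mathcal L$. Spectral spread: $\mathrm{Spr}^+(A)=(\lambda_i(A)-\lambda_{-i}(A))_{i\in\mathbb N}$. Generalized singular values of a bounded operator $T$: $s(T)=(\lambda_i(|T|))_{i\in\mathbb N}$, $|T|=(T^*T)^{1/2}$. Submajorization: for a bounded real sequence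 $a=(a_i)_{i\in\mathbb M}$, $\mathbb M\in\{\mathbb N,\mathbb Z_0\}$, put $a^\downarrow_i=\lambda_i(D_a)$, $i\in\mathbb N$, where $D_a$ is the diagonal operator with diagonal $a$ on $\ell^2(\mathbb M)$; equivalently $\sum_{i=1}^k a_i^\downarrow=\sup\{\sum_{i\in F}a_i: F\subseteq\mathbb M, |F|=k\}$. Then $a\prec_w b$ means $\sum_{i=1}^k a_i^\downarrow\le\sum_{i=1}^k b_i^\downarrow$ for all $k\in\mathbb N$. *)

theory Defs
  imports "HOL-Analysis.Analysis"
begin

section \<open>Complex Hilbert spaces\<close>

text \<open>A complex inner product space is a real inner product space together with a complex
  scalar multiplication extending the real one and a sesquilinear form, linear in its
  \<^emph>\<open>first\<close> argument, whose real part is the real inner product. Norm and topology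
  are thus those of the library.\<close>

class complex_inner = real_inner +
  fixes scaleC :: "complex \<Rightarrow> 'a \<Rightarrow> 'a"  (infixr \<open>*\<^sub>C\<close> 75)
    and cinner :: "'a \<Rightarrow> 'a \<Rightarrow> complex"
  assumes scaleC_add_right: "c *\<^sub>C (x + y) = c *\<^sub>C x + c *\<^sub>C y"
    and scaleC_add_left: "(c + d) *\<^sub>C x = c *\<^sub>C x + d *\<^sub>C x"
    and scaleC_scaleC: "c *\<^sub>C (d *\<^sub>C x) = (c * d) *\<^sub>C x"
    and scaleC_one: "1 *\<^sub>C x = x"
    and scaleR_scaleC: "scaleR r x = complex_of_real r *\<^sub>C x"
    and cinner_commute: "cinner x y = cnj (cinner y x)"
    and cinner_add_left: "cinner (x + y) z = cinner x z + cinner y z"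
    and cinner_scaleC_left: "cinner (c *\<^sub>C x) y = c * cinner x y"
    and inner_eq_Re_cinner: "inner x y = Re (cinner x y)"

class chilbert_space = complex_inner + complete_space

global_interpretation complex_vector:
  vector_space "scaleC :: complex \<Rightarrow> 'a::complex_inner \<Rightarrow> 'a"
  defines cspan = complex_vector.span
    and cdependent = complex_vector.dependent
  by unfold_locales
    (simp_all add: scaleC_add_right scaleC_add_left scaleC_scaleC scaleC_one)

text \<open>\<^term>\<open>has_cdim V n\<close>: \<open>V\<close> is a complex linear subspace of finite dimension \<open>n\<close>.
  (The library's dimension function is \<open>0\<close> on infinite-dimensional spaces.)\<close>

definition has_cdim :: "'a::complex_inner set \<Rightarrow> nat \<Rightarrow> bool" where
  "has_cdim V n \<longleftrightarrow> (\<exists>B. finite B \<and> card B = n \<and> \<not> cdependent B \<and> cspan B = V)"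

definition infinite_cdim :: "'a::complex_inner set \<Rightarrow> bool" where
  "infinite_cdim V \<longleftrightarrow> (\<forall>n. \<not> has_cdim V n)"

definition ortho_compl :: "'a::complex_inner set \<Rightarrow> 'a set" where
  "ortho_compl V = {x. \<forall>y\<in>V. cinner x y = 0}"

instantiation prod :: (complex_inner, complex_inner) complex_inner
begin

definition scaleC_prod_def: "c *\<^sub>C x = (c *\<^sub>C fst x, c *\<^sub>C snd x)"

definition cinner_prod_def: "cinner x y = cinner (fst x) (fst y) + cinner (snd x) (snd y)"

instance
proof
  fix x y z :: "'a \<times> 'b" and c d :: complex and r :: real
  show "c *\<^sub>C (x + y) = c *\<^sub>C x + c *\<^sub>C y"
    by (simp add: scaleC_prod_def scaleC_add_right)
  show "(c + d) *\<^sub>C x = c *\<^sub>C x + d *\<^sub>C x"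
    by (simp add: scaleC_prod_def scaleC_add_left)
  show "c *\<^sub>C d *\<^sub>C x = (c * d) *\<^sub>C x"
    by (simp add: scaleC_prod_def scaleC_scaleC)
  show "1 *\<^sub>C x = x"
    by (simp add: scaleC_prod_def scaleC_one)
  show "r *\<^sub>R x = complex_of_real r *\<^sub>C x"
    by (simp add: scaleC_prod_def scaleR_prod_def scaleR_scaleC)
  show "cinner x y = cnj (cinner y x)"
    unfolding cinner_prod_def complex_cnj_add
    by (rule arg_cong2[where f = "(+)"]; rule cinner_commute)
  show "cinner (x + y) z = cinner x z + cinner y z"
    by (simp add: cinner_prod_def cinner_add_left)
  show "cinner (c *\<^sub>C x) y = c * cinner x y"
    by (simp add: cinner_prod_def scaleC_prod_def cinner_scaleC_left distrib_left)
  show "inner x y = Re (cinner x y)"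
    by (simp add: cinner_prod_def inner_prod_def inner_eq_Re_cinner)
qed

end

instance prod :: (chilbert_space, chilbert_space) chilbert_space ..


section \<open>Bounded operators\<close>

definition bounded_clinear :: "('a::complex_inner \<Rightarrow> 'b::complex_inner) \<Rightarrow> bool" where
  "bounded_clinear T \<longleftrightarrow> bounded_linear T \<and> (\<forall>c x. T (c *\<^sub>C x) = c *\<^sub>C T x)"

definition cadjoint :: "('a::chilbert_space \<Rightarrow> 'b::chilbert_space) \<Rightarrow> 'b \<Rightarrow> 'a" where
  "cadjoint T = (THE T'. \<forall>x y. cinner (T x) y = cinner x (T' y))"

definition selfadjoint :: "('a::chilbert_space \<Rightarrow> 'a) \<Rightarrow> bool" where
  "selfadjoint T \<longleftrightarrow> bounded_clinear T \<and> cadjoint T = T"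

definition positive_op :: "('a::chilbert_space \<Rightarrow> 'a) \<Rightarrow> bool" where
  "positive_op T \<longleftrightarrow> selfadjoint T \<and> (\<forall>x. 0 \<le> Re (cinner (T x) x))"

definition op_sqrt :: "('a::chilbert_space \<Rightarrow> 'a) \<Rightarrow> 'a \<Rightarrow> 'a" where
  "op_sqrt T = (THE R. positive_op R \<and> R \<circ> R = T)"

definition op_abs :: "('a::chilbert_space \<Rightarrow> 'b::chilbert_space) \<Rightarrow> 'a \<Rightarrow> 'a" where
  "op_abs T = op_sqrt (cadjoint T \<circ> T)"

definition op_kernel :: "('a::chilbert_space \<Rightarrow> 'b::chilbert_space) \<Rightarrow> 'a set" where
  "op_kernel T = {x. T x = 0}"

definition block_diag ::
  "('a::chilbert_space \<Rightarrow> 'a) \<Rightarrow> ('b::chilbert_space \<Rightarrow> 'b) \<Rightarrow> 'a \<times> 'b \<Rightarrow> 'a \<times> 'b" where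
  "block_diag A B = (\<lambda>(x, y). (A x, B y))"


section \<open>Spectral scale, spectral spread, singular values\<close>

text \<open>Only indices \<open>i \<noteq> 0\<close> are meaningful. For self-adjoint \<open>A\<close> the quadratic form
  \<^term>\<open>cinner (A x) x\<close> is real, so taking its real part is harmless.\<close>

definition spectral_scale :: "('a::chilbert_space \<Rightarrow> 'a) \<Rightarrow> int \<Rightarrow> real" where
  "spectral_scale A i =
    (if i > 0
     then INF V\<in>{V. has_cdim V (nat i - 1)}.
            SUP x\<in>{x \<in> ortho_compl V. norm x = 1}. Re (cinner (A x) x)
     else SUP V\<in>{V. has_cdim V (nat (- i) - 1)}.
            INF x\<in>{x \<in> ortho_compl V. norm x = 1}. Re (cinner (A x) x))"

text \<open>A sequence indexed by \<open>{1, 2, \<dots>}\<close> is represented by a function on \<^typ>\<open>nat\<close> whose value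
  at \<open>n\<close> is the entry with index \<open>n + 1\<close>.\<close>

definition spectral_spread :: "('a::chilbert_space \<Rightarrow> 'a) \<Rightarrow> nat \<Rightarrow> real" where
  "spectral_spread A n = spectral_scale A (int (Suc n)) - spectral_scale A (- int (Suc n))"

definition singular_values :: "('a::chilbert_space \<Rightarrow> 'b::chilbert_space) \<Rightarrow> nat \<Rightarrow> real" where
  "singular_values T n = spectral_scale (op_abs T) (int (Suc n))"


section \<open>The Hilbert space of square-summable families\<close>

typedef 'i ell2 = "{x :: 'i \<Rightarrow> complex. (\<lambda>i. (cmod (x i))\<^sup>2) summable_on UNIV}"
  by (rule exI[of _ "\<lambda>_. 0"]) simp

setup_lifting type_definition_ell2

lemma ell2_summable_add:
  assumes "(\<lambda>i. (cmod (x i))\<^sup>2) summable_on UNIV" "(\<lambda>i. (cmod (y i))\<^sup>2) summable_on UNIV"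
  shows "(\<lambda>i. (cmod (x i + y i))\<^sup>2) summable_on UNIV"
proof (rule summable_on_comparison_test)
  show "(\<lambda>i. 2 * (cmod (x i))\<^sup>2 + 2 * (cmod (y i))\<^sup>2) summable_on UNIV"
    by (intro summable_on_add summable_on_cmult_right assms)
  fix i
  have "(cmod (x i + y i))\<^sup>2 \<le> (cmod (x i) + cmod (y i))\<^sup>2"
    by (simp add: norm_triangle_ineq power_mono)
  also have "\<dots> \<le> 2 * (cmod (x i))\<^sup>2 + 2 * (cmod (y i))\<^sup>2"
    using sum_squares_bound[of "cmod (x i)" "cmod (y i)"] by (simp add: power2_sum)
  finally show "(cmod (x i + y i))\<^sup>2 \<le> 2 * (cmod (x i))\<^sup>2 + 2 * (cmod (y i))\<^sup>2" .
qed auto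

lemma ell2_summable_scale:
  assumes "(\<lambda>i. (cmod (x i))\<^sup>2) summable_on UNIV"
  shows "(\<lambda>i. (cmod (c * x i))\<^sup>2) summable_on UNIV"
  by (simp add: norm_mult power_mult_distrib summable_on_cmult_right assms)

lemma ell2_summable_mult:
  assumes "(\<lambda>i. (cmod (x i))\<^sup>2) summable_on UNIV" "(\<lambda>i. (cmod (y i))\<^sup>2) summable_on UNIV"
  shows "(\<lambda>i. x i * cnj (y i)) summable_on UNIV"
proof (rule abs_summable_summable, rule summable_on_comparison_test)
  show "(\<lambda>i. (cmod (x i))\<^sup>2 + (cmod (y i))\<^sup>2) summable_on UNIV"
    by (intro summable_on_add assms)
  fix i
  have "2 * (cmod (x i) * cmod (y i)) \<le> (cmod (x i))\<^sup>2 + (cmod (y i))\<^sup>2"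
    using sum_squares_bound[of "cmod (x i)" "cmod (y i)"] by simp
  moreover have "0 \<le> cmod (x i) * cmod (y i)"
    by simp
  ultimately show "norm (x i * cnj (y i)) \<le> (cmod (x i))\<^sup>2 + (cmod (y i))\<^sup>2"
    unfolding norm_mult complex_mod_cnj by linarith
qed auto

lemma Rep_ell2_summable: "(\<lambda>i. (cmod (Rep_ell2 x i))\<^sup>2) summable_on UNIV"
  using Rep_ell2[of x] by simp

lemma Rep_ell2_summable_mult: "(\<lambda>i. Rep_ell2 x i * cnj (Rep_ell2 y i)) summable_on UNIV"
  by (intro ell2_summable_mult Rep_ell2_summable)

instantiation ell2 :: (type) complex_inner
begin

lift_definition zero_ell2 :: "'a ell2" is "\<lambda>_. 0" by simp

lift_definition plus_ell2 :: "'a ell2 \<Rightarrow> 'a ell2 \<Rightarrow> 'a ell2" is "\<lambda>x y i. x i + y i"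
  by (rule ell2_summable_add)

lift_definition uminus_ell2 :: "'a ell2 \<Rightarrow> 'a ell2" is "\<lambda>x i. - x i" by simp

definition minus_ell2 :: "'a ell2 \<Rightarrow> 'a ell2 \<Rightarrow> 'a ell2" where
  "minus_ell2 x y = x + - y"

lift_definition scaleC_ell2 :: "complex \<Rightarrow> 'a ell2 \<Rightarrow> 'a ell2" is "\<lambda>c x i. c * x i"
  by (rule ell2_summable_scale)

definition scaleR_ell2 :: "real \<Rightarrow> 'a ell2 \<Rightarrow> 'a ell2" where
  "scaleR_ell2 r x = complex_of_real r *\<^sub>C x"

lift_definition cinner_ell2 :: "'a ell2 \<Rightarrow> 'a ell2 \<Rightarrow> complex"
  is "\<lambda>x y. \<Sum>\<^sub>\<infinity>i. x i * cnj (y i)" .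

definition inner_ell2 :: "'a ell2 \<Rightarrow> 'a ell2 \<Rightarrow> real" where
  "inner_ell2 x y = Re (cinner x y)"

definition norm_ell2 :: "'a ell2 \<Rightarrow> real" where
  "norm_ell2 x = sqrt (inner x x)"

definition dist_ell2 :: "'a ell2 \<Rightarrow> 'a ell2 \<Rightarrow> real" where
  "dist_ell2 x y = norm (x - y)"

definition sgn_ell2 :: "'a ell2 \<Rightarrow> 'a ell2" where
  "sgn_ell2 x = inverse (norm x) *\<^sub>R x"

definition uniformity_ell2 :: "('a ell2 \<times> 'a ell2) filter" where
  "uniformity_ell2 = (INF e\<in>{0<..}. principal {(x, y). dist x y < e})"

definition open_ell2 :: "'a ell2 set \<Rightarrow> bool" where
  "open_ell2 U \<longleftrightarrow> (\<forall>x\<in>U. eventually (\<lambda>(x', y). x' = x \<longrightarrow> y \<in> U) uniformity)"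

instance
proof
  have inner_self: "inner x x = (\<Sum>\<^sub>\<infinity>i. (cmod (Rep_ell2 x i))\<^sup>2)" for x :: "'a ell2"
  proof -
    have "Re (\<Sum>\<^sub>\<infinity>i. Rep_ell2 x i * cnj (Rep_ell2 x i)) =
        (\<Sum>\<^sub>\<infinity>i. Re (Rep_ell2 x i * cnj (Rep_ell2 x i)))"
      by (rule infsum_Re[symmetric]) (rule Rep_ell2_summable_mult)
    also have "\<dots> = (\<Sum>\<^sub>\<infinity>i. (cmod (Rep_ell2 x i))\<^sup>2)"
      by (simp add: complex_mult_cnj cmod_power2)
    finally show ?thesis
      by (simp add: inner_ell2_def cinner_ell2.rep_eq)
  qed
  have commute: "cinner x y = cnj (cinner y x)" for x y :: "'a ell2"
    by transfer (simp add: infsum_cnj[symmetric] mult.commute del: infsum_cnj)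
  have add: "cinner (x + y) z = cinner x z + cinner y z" for x y z :: "'a ell2"
    by transfer (simp add: distrib_right infsum_add ell2_summable_mult)
  have scale: "cinner (c *\<^sub>C x) y = c * cinner x y" for c and x y :: "'a ell2"
    by transfer (simp add: mult.assoc infsum_cmult_right')
  fix x y z :: "'a ell2" and r s :: real and c d :: complex
  show "x + y + z = x + (y + z)" by transfer (simp add: add.assoc)
  show "x + y = y + x" by transfer (simp add: add.commute)
  show "0 + x = x" by transfer simp
  show "- x + x = 0" by transfer simp
  show "x - y = x + - y" by (rule minus_ell2_def)
  show "r *\<^sub>R (x + y) = r *\<^sub>R x + r *\<^sub>R y"
    unfolding scaleR_ell2_def by transfer (simp add: distrib_left)
  show "(r + s) *\<^sub>R x = r *\<^sub>R x + s *\<^sub>R x"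
    unfolding scaleR_ell2_def by transfer (simp add: distrib_right)
  show "r *\<^sub>R s *\<^sub>R x = (r * s) *\<^sub>R x"
    unfolding scaleR_ell2_def by transfer (simp add: mult.assoc)
  show "1 *\<^sub>R x = x"
    unfolding scaleR_ell2_def by transfer simp
  show "dist x y = norm (x - y)" by (rule dist_ell2_def)
  show "sgn x = inverse (norm x) *\<^sub>R x" by (rule sgn_ell2_def)
  show "uniformity = (INF e\<in>{0<..}. principal {(x::'a ell2, y). dist x y < e})"
    by (rule uniformity_ell2_def)
  show "open U \<longleftrightarrow> (\<forall>x\<in>U. eventually (\<lambda>(x', y). x' = x \<longrightarrow> y \<in> U) uniformity)"
    for U :: "'a ell2 set" by (rule open_ell2_def)
  show "inner x y = inner y x"
    unfolding inner_ell2_def using commute[of x y] by simp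
  show "inner (x + y) z = inner x z + inner y z"
    by (simp add: inner_ell2_def add)
  show "inner (r *\<^sub>R x) y = r * inner x y"
    by (simp add: inner_ell2_def scaleR_ell2_def scale)
  show "0 \<le> inner x x"
    unfolding inner_self by (rule infsum_nonneg) simp
  show "inner x x = 0 \<longleftrightarrow> x = 0"
  proof
    assume "inner x x = 0"
    then have "(\<Sum>\<^sub>\<infinity>i. (cmod (Rep_ell2 x i))\<^sup>2) \<le> 0"
      by (simp add: inner_self)
    then have "(cmod (Rep_ell2 x i))\<^sup>2 = 0" for i
      by (rule nonneg_infsum_le_0D[OF _ Rep_ell2_summable]) auto
    then show "x = 0"
      by transfer auto
  qed (simp add: inner_self zero_ell2.rep_eq)
  show "norm x = sqrt (inner x x)" by (rule norm_ell2_def)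
  show "c *\<^sub>C (x + y) = c *\<^sub>C x + c *\<^sub>C y" by transfer (simp add: distrib_left)
  show "(c + d) *\<^sub>C x = c *\<^sub>C x + d *\<^sub>C x" by transfer (simp add: distrib_right)
  show "c *\<^sub>C d *\<^sub>C x = (c * d) *\<^sub>C x" by transfer (simp add: mult.assoc)
  show "1 *\<^sub>C x = x" by transfer simp
  show "r *\<^sub>R x = complex_of_real r *\<^sub>C x" by (rule scaleR_ell2_def)
  show "cinner x y = cnj (cinner y x)" by (rule commute)
  show "cinner (x + y) z = cinner x z + cinner y z" by (rule add)
  show "cinner (c *\<^sub>C x) y = c * cinner x y" by (rule scale)
  show "inner x y = Re (cinner x y)" by (rule inner_ell2_def)
qed

end

lemma norm_ell2_power2: "(norm x)\<^sup>2 = (\<Sum>\<^sub>\<infinity>i. (cmod (Rep_ell2 x i))\<^sup>2)"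
proof -
  have "(norm x)\<^sup>2 = inner x x"
    by (rule power2_norm_eq_inner)
  also have "\<dots> = Re (\<Sum>\<^sub>\<infinity>i. Rep_ell2 x i * cnj (Rep_ell2 x i))"
    by (simp add: inner_ell2_def cinner_ell2.rep_eq)
  also have "\<dots> = (\<Sum>\<^sub>\<infinity>i. Re (Rep_ell2 x i * cnj (Rep_ell2 x i)))"
    by (rule infsum_Re[symmetric]) (rule Rep_ell2_summable_mult)
  also have "\<dots> = (\<Sum>\<^sub>\<infinity>i. (cmod (Rep_ell2 x i))\<^sup>2)"
    by (simp add: complex_mult_cnj cmod_power2)
  finally show ?thesis .
qed

lemma Rep_ell2_diff: "Rep_ell2 (x - y) i = Rep_ell2 x i - Rep_ell2 y i"
  unfolding minus_ell2_def plus_ell2.rep_eq uminus_ell2.rep_eq by simp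

lemma ell2_finite_sum_le: "finite F \<Longrightarrow> (\<Sum>i\<in>F. (cmod (Rep_ell2 x i))\<^sup>2) \<le> (norm x)\<^sup>2"
  unfolding norm_ell2_power2 by (rule finite_sum_le_infsum) (auto simp: Rep_ell2_summable)

lemma cmod_Rep_ell2_le: "cmod (Rep_ell2 x i) \<le> norm x"
proof -
  have "(cmod (Rep_ell2 x i))\<^sup>2 \<le> (norm x)\<^sup>2"
    using ell2_finite_sum_le[of "{i}" x] by simp
  then show ?thesis
    by (rule power2_le_imp_le) simp
qed

instance ell2 :: (type) chilbert_space
proof
  fix X :: "nat \<Rightarrow> 'a ell2"
  assume X: "Cauchy X"
  define f where "f i = lim (\<lambda>n. Rep_ell2 (X n) i)" for i
  have f: "(\<lambda>n. Rep_ell2 (X n) i) \<longlonglongrightarrow> f i" for i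
  proof -
    have "Cauchy (\<lambda>n. Rep_ell2 (X n) i)"
    proof (rule metric_CauchyI)
      fix e :: real assume "e > 0"
      then obtain M where M: "\<And>m n. m \<ge> M \<Longrightarrow> n \<ge> M \<Longrightarrow> dist (X m) (X n) < e"
        using metric_CauchyD[OF X] by blast
      have "dist (Rep_ell2 (X m) i) (Rep_ell2 (X n) i) \<le> dist (X m) (X n)" for m n
        using cmod_Rep_ell2_le[of "X m - X n" i] by (simp add: Rep_ell2_diff dist_norm)
      then show "\<exists>M. \<forall>m\<ge>M. \<forall>n\<ge>M. dist (Rep_ell2 (X m) i) (Rep_ell2 (X n) i) < e"
        using M by (meson le_less_trans)
    qed
    then show ?thesis
      unfolding f_def by (simp add: Cauchy_convergent_iff convergent_LIMSEQ_iff)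
  qed
  have bound: "(\<Sum>i\<in>F. (cmod (Rep_ell2 (X m) i - f i))\<^sup>2) \<le> e\<^sup>2"
    if "\<And>n. n \<ge> m \<Longrightarrow> dist (X m) (X n) < e" "finite F" for m e F
  proof (rule LIMSEQ_le_const2)
    show "(\<lambda>n. \<Sum>i\<in>F. (cmod (Rep_ell2 (X m) i - Rep_ell2 (X n) i))\<^sup>2)
        \<longlonglongrightarrow> (\<Sum>i\<in>F. (cmod (Rep_ell2 (X m) i - f i))\<^sup>2)"
      by (intro tendsto_intros f)
    have "(\<Sum>i\<in>F. (cmod (Rep_ell2 (X m) i - Rep_ell2 (X n) i))\<^sup>2) \<le> e\<^sup>2" if "n \<ge> m" for n
    proof -
      have "(\<Sum>i\<in>F. (cmod (Rep_ell2 (X m) i - Rep_ell2 (X n) i))\<^sup>2) \<le> (norm (X m - X n))\<^sup>2"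
        using ell2_finite_sum_le[OF \<open>finite F\<close>, of "X m - X n"] by (simp add: Rep_ell2_diff)
      also have "\<dots> \<le> e\<^sup>2"
        using \<open>\<And>n. n \<ge> m \<Longrightarrow> dist (X m) (X n) < e\<close>[OF that]
        by (intro power_mono) (auto simp: dist_norm)
      finally show ?thesis .
    qed
    then show "\<exists>N. \<forall>n\<ge>N. (\<Sum>i\<in>F. (cmod (Rep_ell2 (X m) i - Rep_ell2 (X n) i))\<^sup>2) \<le> e\<^sup>2"
      by blast
  qed
  have summable: "(\<lambda>i. (cmod (Rep_ell2 (X m) i - f i))\<^sup>2) summable_on UNIV"
    if "\<And>n. n \<ge> m \<Longrightarrow> dist (X m) (X n) < e" for m e
  proof (rule nonneg_bdd_above_summable_on)
    show "bdd_above (sum (\<lambda>i. (cmod (Rep_ell2 (X m) i - f i))\<^sup>2) ` {F. F \<subseteq> UNIV \<and> finite F})"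
    proof (rule bdd_aboveI2)
      show "(\<Sum>i\<in>F. (cmod (Rep_ell2 (X m) i - f i))\<^sup>2) \<le> e\<^sup>2"
        if F: "F \<in> {F. F \<subseteq> UNIV \<and> finite F}" for F
        by (rule bound[OF \<open>\<And>n. n \<ge> m \<Longrightarrow> dist (X m) (X n) < e\<close>]) (use F in simp_all)
    qed
  qed simp
  obtain M1 where "\<And>m n. m \<ge> M1 \<Longrightarrow> n \<ge> M1 \<Longrightarrow> dist (X m) (X n) < 1"
    using metric_CauchyD[OF X, of 1] by auto
  then have s: "(\<lambda>i. (cmod (Rep_ell2 (X M1) i - f i))\<^sup>2) summable_on UNIV"
    by (intro summable[of M1 1]) simp
  have "(\<lambda>i. (cmod (- 1 * (Rep_ell2 (X M1) i - f i)))\<^sup>2) summable_on UNIV"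
    by (rule ell2_summable_scale[OF s])
  from ell2_summable_add[OF Rep_ell2_summable[of "X M1"] this]
  have f_ell2: "(\<lambda>i. (cmod (f i))\<^sup>2) summable_on UNIV"
    by simp
  define x where "x = Abs_ell2 f"
  have Rep_x: "Rep_ell2 x = f"
    unfolding x_def using f_ell2 by (simp add: Abs_ell2_inverse)
  have "X \<longlonglongrightarrow> x"
  proof (rule metric_LIMSEQ_I)
    fix e :: real assume "e > 0"
    then obtain M where M: "\<And>m n. m \<ge> M \<Longrightarrow> n \<ge> M \<Longrightarrow> dist (X m) (X n) < e / 2"
      using metric_CauchyD[OF X, of "e / 2"] by auto
    have "dist (X m) x < e" if "m \<ge> M" for m
    proof -
      have d: "\<And>n. n \<ge> m \<Longrightarrow> dist (X m) (X n) < e / 2"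
        using M that by auto
      have "(norm (X m - x))\<^sup>2 \<le> (e / 2)\<^sup>2"
        unfolding norm_ell2_power2 Rep_ell2_diff Rep_x
        by (rule infsum_le_finite_sums[OF summable[OF d]], assumption, rule bound[OF d])
      then have "norm (X m - x) \<le> e / 2"
        by (rule power2_le_imp_le) (use \<open>e > 0\<close> in simp)
      then show ?thesis
        using \<open>e > 0\<close> by (simp add: dist_norm)
    qed
    then show "\<exists>M. \<forall>m\<ge>M. dist (X m) x < e"
      by blast
  qed
  then show "convergent X"
    by (rule convergentI)
qed


section \<open>Submajorization\<close>

text \<open>The sequences below are meant to be bounded, so that the multiplication operator
  maps \<open>\<ell>\<^sup>2\<close> to itself.\<close>

definition diag_op :: "('i \<Rightarrow> real) \<Rightarrow> 'i ell2 \<Rightarrow> 'i ell2" where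
  "diag_op a x = Abs_ell2 (\<lambda>i. complex_of_real (a i) * Rep_ell2 x i)"

definition decr :: "('i \<Rightarrow> real) \<Rightarrow> nat \<Rightarrow> real" where
  "decr a n = spectral_scale (diag_op a) (int (Suc n))"

definition submajorized :: "('i \<Rightarrow> real) \<Rightarrow> ('j \<Rightarrow> real) \<Rightarrow> bool"  (infix \<open>\<prec>\<^sub>w\<close> 50) where
  "a \<prec>\<^sub>w b \<longleftrightarrow> (\<forall>k. (\<Sum>n<k. decr a n) \<le> (\<Sum>n<k. decr b n))"

end

(* Idea. Since C^*C + S^*S = P is a projection, C^* = P C^* and S^* = P S^*, and (a, b) |-> C^*a + S^*b
   is a contraction. For orthonormal x_1, ..., x_k and a contraction U with
   <SEC^* x, U x> close to <|SEC^*| x, x>, polarization writes 2 Re <SEC^* x_i, U x_i> as the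
   difference of the values of the form of PEP at two contractive images of x_i. Adding defect
   vectors in the zero summand (or in ker P) turns each of these two families of images into an
   orthonormal one without changing the values, and Ky Fan's inequality bounds the two sums by
   the sums of the upper and of the lower spectral scale. *)

theory Submission
  imports Defs
begin

section \<open>Complex inner product spaces\<close>

text \<open>The contractive images of the \<open>x i\<close> have a Gram matrix that is only bounded
  by the identity, whereas Ky Fan's inequality asks for orthonormal families. The difference is
  itself the Gram matrix of defect vectors, which must lie where the operator vanishes and
  orthogonally to the range of \<open>P\<close>: this is the room that the zero summand or an
  infinite-dimensional kernel provides. The two images are (C^* x + S^* U x) / sqrt 2 and (C^* x -
  S^* U x) / sqrt 2; the factor 1 / sqrt 2 makes them contractive and leaves exactly the 2 of the
  claim. Nothing is compact, so the extrema in the min-max formulas may fail to be attained; every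
  extremal choice, and also the polar factor of SEC^*, is therefore taken up to an error that is
  removed at the end. Since \<open>cadjoint\<close> and \<open>op_sqrt\<close> are definite
  descriptions, existence and uniqueness of adjoints and positive roots come first. For the
  sequences two one-sided comparisons suffice: rearrangement does not raise the entries of a
  decreasing sequence, and it does not lower the partial sums of a bounded one.\<close>

instance chilbert_space \<subseteq> banach ..

lemma cinner_add_right: "cinner x (y + z) = cinner x y + cinner x z"
  by (metis cinner_add_left cinner_commute complex_cnj_add)

lemma cinner_scaleC_right: "cinner x (c *\<^sub>C y) = cnj c * cinner x y"
  by (metis cinner_commute cinner_scaleC_left complex_cnj_mult)

lemma cinner_zero_left [simp]: "cinner 0 x = 0"
  using cinner_add_left[of 0 0 x] by simp

lemma cinner_zero_right [simp]: "cinner x 0 = 0"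
  using cinner_add_right[of x 0 0] by simp

lemma cinner_minus_left [simp]: "cinner (- x) y = - cinner x y"
  using cinner_add_left[of x "- x" y] by (simp add: eq_neg_iff_add_eq_0 add.commute)

lemma cinner_minus_right [simp]: "cinner x (- y) = - cinner x y"
  using cinner_add_right[of x y "- y"] by (simp add: eq_neg_iff_add_eq_0 add.commute)

lemma cinner_diff_left: "cinner (x - y) z = cinner x z - cinner y z"
  using cinner_add_left[of x "- y" z] by simp

lemma cinner_diff_right: "cinner x (y - z) = cinner x y - cinner x z"
  using cinner_add_right[of x y "- z"] by simp

lemma cinner_scaleR_left: "cinner (r *\<^sub>R x) y = of_real r * cinner x y"
  by (simp add: scaleR_scaleC cinner_scaleC_left)

lemma cinner_scaleR_right: "cinner x (r *\<^sub>R y) = of_real r * cinner x y"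
  by (simp add: scaleR_scaleC cinner_scaleC_right)

lemmas cinner_simps = cinner_add_left cinner_add_right cinner_diff_left cinner_diff_right
  cinner_scaleC_left cinner_scaleC_right cinner_scaleR_left cinner_scaleR_right

lemma cinner_sum_left: "cinner (sum f I) y = (\<Sum>i\<in>I. cinner (f i) y)"
  by (induction I rule: infinite_finite_induct) (simp_all add: cinner_add_left)

lemma cinner_sum_right: "cinner y (sum f I) = (\<Sum>i\<in>I. cinner y (f i))"
  by (induction I rule: infinite_finite_induct) (simp_all add: cinner_add_right)

lemma cinner_self: "cinner x x = complex_of_real ((norm x)\<^sup>2)"
proof -
  have "Im (cinner x x) = 0"
    using cinner_commute[of x x] by (metis Im_complex_of_real Reals_cnj_iff complex_is_Real_iff)
  then show ?thesis
    by (simp add: complex_eq_iff power2_norm_eq_inner inner_eq_Re_cinner)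
qed

lemma Re_cinner_self [simp]: "Re (cinner x x) = (norm x)\<^sup>2"
  by (simp add: cinner_self)

lemma norm_scaleC: "norm (c *\<^sub>C x) = cmod c * norm x"
proof -
  have "complex_of_real ((norm (c *\<^sub>C x))\<^sup>2) = of_real ((cmod c * norm x)\<^sup>2)"
    unfolding cinner_self[symmetric] power_mult_distrib of_real_mult complex_norm_square
    by (simp add: cinner_simps cinner_self[symmetric])
  then show ?thesis
    unfolding of_real_eq_iff by (simp add: power2_eq_iff_nonneg)
qed

lemma cinner_norm_le: "cmod (cinner x y) \<le> norm x * norm y"
proof (cases "cinner x y = 0")
  case False
  \<comment> \<open>Multiplication by the conjugate phase makes the product real and nonnegative,
    which reduces the claim to the real Cauchy-Schwarz inequality.\<close>
  define c where "c = cnj (sgn (cinner x y))"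
  have "c * cinner x y = of_real (cmod (cinner x y))"
    using False complex_norm_square[of "cinner x y"]
    by (simp add: c_def sgn_eq field_simps power2_eq_square)
  then have "cmod (cinner x y) = Re (cinner (c *\<^sub>C x) y)"
    by (simp add: cinner_simps)
  also have "\<dots> \<le> norm (c *\<^sub>C x) * norm y"
    unfolding inner_eq_Re_cinner[symmetric] by (rule norm_cauchy_schwarz)
  also have "\<dots> = norm x * norm y"
    using False by (simp add: norm_scaleC c_def norm_sgn)
  finally show ?thesis .
qed simp

lemma Re_cinner_le: "\<bar>Re (cinner x y)\<bar> \<le> norm x * norm y"
  using abs_Re_le_cmod cinner_norm_le order_trans by blast

lemma bounded_linear_cinner_left: "bounded_linear (\<lambda>x. cinner x y)"
  by (rule bounded_linear_intro[where K = "norm y"])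
    (simp_all add: cinner_add_left cinner_scaleR_left scaleR_conv_of_real cinner_norm_le)

lemma bounded_linear_cinner_right: "bounded_linear (cinner y)"
  by (rule bounded_linear_intro[where K = "norm y"])
    (simp_all add: cinner_add_right cinner_scaleR_right scaleR_conv_of_real cinner_norm_le
      mult.commute[of _ "norm y"])

lemma cinner_ext_right:
  assumes "\<And>x. cinner x y = cinner x z"
  shows "y = z"
  using assms[of "y - z"] cinner_self[of "y - z"]
  by (simp add: cinner_diff_right)

section \<open>Bounded complex-linear maps\<close>

lemma bounded_clinearD:
  assumes "bounded_clinear T"
  shows "T (x + y) = T x + T y" "T (x - y) = T x - T y" "T (c *\<^sub>C x) = c *\<^sub>C T x"
    "T (r *\<^sub>R x) = r *\<^sub>R T x" "T 0 = 0" "T (- x) = - T x" "T (sum f I) = (\<Sum>i\<in>I. T (f i))"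
    "bounded_linear T"
  using assms unfolding bounded_clinear_def
  by (auto simp: linear_simps linear_sum bounded_linear.linear)

lemma bounded_clinearI:
  assumes "\<And>x y. T (x + y) = T x + T y" "\<And>c x. T (c *\<^sub>C x) = c *\<^sub>C T x"
    "\<And>x. norm (T x) \<le> K * norm x"
  shows "bounded_clinear T"
  unfolding bounded_clinear_def
  by (auto intro!: bounded_linear_intro[where K = K] assms simp: assms(3) mult.commute
      scaleR_scaleC)

lemma bounded_clinear_bound:
  assumes "bounded_clinear T"
  obtains K where "K > 0" "\<And>x. norm (T x) \<le> K * norm x"
  using bounded_linear.pos_bounded[OF bounded_clinearD(8)[OF assms]] by (metis mult.commute)

lemma bounded_clinear_compose:
  assumes S: "bounded_clinear S" and T: "bounded_clinear T"
  shows "bounded_clinear (\<lambda>x. S (T x))"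
  using bounded_linear_compose[OF bounded_clinearD(8)[OF S] bounded_clinearD(8)[OF T]] assms
  by (simp add: bounded_clinear_def)

lemma bounded_clinear_add:
  assumes "bounded_clinear S" "bounded_clinear T"
  shows "bounded_clinear (\<lambda>x. S x + T x)"
  using assms by (simp add: bounded_clinear_def bounded_linear_add scaleC_add_right)

lemma bounded_clinear_scaleC:
  assumes "bounded_clinear T"
  shows "bounded_clinear (\<lambda>x. c *\<^sub>C T x)"
proof -
  obtain K where K: "\<And>x. norm (T x) \<le> K * norm x"
    using bounded_clinear_bound[OF assms] by metis
  show ?thesis
    by (rule bounded_clinearI[where K = "cmod c * K"])
      (auto simp: bounded_clinearD[OF assms] scaleC_add_right scaleC_scaleC norm_scaleC
        mult.assoc mult.commute[of c] intro!: mult_left_mono K)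
qed

lemma bounded_clinear_ident: "bounded_clinear (\<lambda>x. x)"
  by (simp add: bounded_clinear_def)

lemma bounded_clinear_minus:
  assumes "bounded_clinear T"
  shows "bounded_clinear (\<lambda>x. - T x)"
  using bounded_clinear_scaleC[OF assms, of "-1"]
  by (simp add: complex_vector.scale_minus_left scaleC_one)

lemma bounded_clinear_diff:
  assumes "bounded_clinear S" "bounded_clinear T"
  shows "bounded_clinear (\<lambda>x. S x - T x)"
  using bounded_clinear_add[OF assms(1) bounded_clinear_minus[OF assms(2)]] by simp


section \<open>Lax--Milgram and adjoints\<close>

text \<open>Otherwise the linear term would win for small \<open>t\<close> of sign opposite to
  \<open>a\<close>. In this form minimality of a quadratic functional yields the vanishing of its
  first variation.\<close>

lemma nonneg_quadratic_imp_zero: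
  fixes a b :: real
  assumes "\<And>t. 0 \<le> t * a + t\<^sup>2 * b"
  shows "a = 0"
proof (rule ccontr)
  assume a: "a \<noteq> 0"
  define c where "c = \<bar>b\<bar> + 1"
  have c: "c > 0" "b < c" by (auto simp: c_def)
  have "0 \<le> (- a / c) * a + (- a / c)\<^sup>2 * b"
    by (rule assms)
  also have "\<dots> = a\<^sup>2 / c * (b / c - 1)"
    using c by (simp add: field_simps power2_eq_square)
  also have "\<dots> < 0"
    using a c by (intro mult_pos_neg) (auto simp: field_simps)
  finally show False by simp
qed

text \<open>The representing vector minimizes \<open>\<langle>Qx, x\<rangle> / 2 - \<phi> x\<close>; minimizing sequences are Cauchy
  by the parallelogram law and coercivity.\<close>

lemma symmetric_lax_milgram:
  fixes Q :: "'a::{real_inner,complete_space} \<Rightarrow> 'a" and \<phi> :: "'a \<Rightarrow> real"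
  assumes Q: "bounded_linear Q" and sym: "\<And>x y. inner (Q x) y = inner x (Q y)"
    and coercive: "\<And>x. \<delta> * (norm x)\<^sup>2 \<le> inner (Q x) x" and \<delta>: "\<delta> > 0"
    and \<phi>: "bounded_linear \<phi>"
  shows "\<exists>x. \<forall>z. \<phi> z = inner (Q x) z"
proof -
  interpret Q: bounded_linear Q by fact
  interpret \<phi>: bounded_linear \<phi> by fact
  define J where "J x = inner (Q x) x / 2 - \<phi> x" for x
  obtain K where K: "\<And>x. norm (\<phi> x) \<le> norm x * K"
    using \<phi>.bounded by blast
  \<comment> \<open>Coercivity lets the quadratic term absorb the linear one: complete the
    square.\<close>
  have lower: "- (K\<^sup>2 / (2 * \<delta>)) \<le> J x" for x
  proof -
    have "\<phi> x \<le> norm x * K" using K[of x] by simp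
    moreover have "0 \<le> (\<delta> * norm x - K)\<^sup>2 / (2 * \<delta>)" using \<delta> by simp
    then have "norm x * K \<le> \<delta> * (norm x)\<^sup>2 / 2 + K\<^sup>2 / (2 * \<delta>)"
      using \<delta> by (simp add: power2_diff field_simps power2_eq_square)
    ultimately show ?thesis
      using coercive[of x] unfolding J_def by linarith
  qed
  define m where "m = Inf (range J)"
  have bdd: "bdd_below (range J)"
    using lower by (auto intro!: bdd_belowI2)
  have m_le: "m \<le> J x" for x
    unfolding m_def by (rule cInf_lower) (auto intro: bdd)
  have "\<exists>x. J x < m + 1 / real (Suc n)" for n
    using cInf_lessD[of "range J" "m + 1 / real (Suc n)"] by (auto simp: m_def)
  then obtain X where X: "\<And>n. J (X n) < m + 1 / real (Suc n)"
    by metis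
  \<comment> \<open>The linear part of \<open>J\<close> cancels at the midpoint; the quadratic part
    leaves one eighth of the form at \<open>x - y\<close>.\<close>
  have mid: "\<delta> * (norm (x - y))\<^sup>2 / 8 \<le> (J x + J y) / 2 - J ((1/2) *\<^sub>R (x + y))" for x y
  proof -
    have "(J x + J y) / 2 - J ((1/2) *\<^sub>R (x + y)) = inner (Q (x - y)) (x - y) / 8"
      using sym[of x y] sym[of y x]
      by (simp add: J_def Q.add Q.diff Q.scaleR \<phi>.add \<phi>.scaleR inner_simps inner_commute field_simps)
    then show ?thesis
      using coercive[of "x - y"] by simp
  qed
  have "Cauchy X"
  proof (rule metric_CauchyI)
    fix e :: real assume e: "e > 0"
    obtain N where N: "inverse (real (Suc N)) < \<delta> * e\<^sup>2 / 8"
      using reals_Archimedean[of "\<delta> * e\<^sup>2 / 8"] e \<delta> by auto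
    have "dist (X p) (X q) < e" if "p \<ge> N" "q \<ge> N" for p q
    proof -
      have J: "J (X r) < m + \<delta> * e\<^sup>2 / 8" if "r \<ge> N" for r
      proof -
        have "1 / real (Suc r) \<le> inverse (real (Suc N))"
          using that by (simp add: field_simps)
        then show ?thesis using X[of r] N by linarith
      qed
      have "\<delta> * (norm (X p - X q))\<^sup>2 / 8 < \<delta> * e\<^sup>2 / 8"
        using J[OF that(1)] J[OF that(2)] mid[of "X p" "X q"]
          m_le[of "(1/2) *\<^sub>R (X p + X q)"] by (simp add: field_simps)
      then have "(norm (X p - X q))\<^sup>2 < e\<^sup>2"
        using \<delta> by simp
      then show ?thesis
        using e by (simp add: dist_norm power2_less_imp_less)
    qed
    then show "\<exists>M. \<forall>p\<ge>M. \<forall>q\<ge>M. dist (X p) (X q) < e" by blast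
  qed
  then obtain x where x: "X \<longlonglongrightarrow> x"
    using Cauchy_convergent convergent_def by blast
  have "(\<lambda>n. J (X n)) \<longlonglongrightarrow> J x"
    unfolding J_def by (intro tendsto_intros Q.tendsto \<phi>.tendsto x) simp
  moreover have "(\<lambda>n. m + 1 / real (Suc n)) \<longlonglongrightarrow> m + 0"
    by (intro tendsto_intros LIMSEQ_Suc[OF lim_1_over_n])
  ultimately have "J x \<le> m + 0"
    by (rule LIMSEQ_le) (use X in \<open>auto intro: less_imp_le\<close>)
  then have min: "J x \<le> J y" for y
    using m_le[of y] by simp
  have "inner (Q x) z - \<phi> z = 0" for z
  proof (rule nonneg_quadratic_imp_zero)
    fix t :: real
    have "0 \<le> J (x + t *\<^sub>R z) - J x"
      using min[of "x + t *\<^sub>R z"] by simp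
    also have "\<dots> = t * (inner (Q x) z - \<phi> z) + t\<^sup>2 * (inner (Q z) z / 2)"
      using sym[of x z] sym[of z x]
      by (simp add: J_def Q.add Q.scaleR \<phi>.add \<phi>.scaleR inner_simps inner_commute field_simps
          power2_eq_square)
    finally show "0 \<le> t * (inner (Q x) z - \<phi> z) + t\<^sup>2 * (inner (Q z) z / 2)" .
  qed
  then show ?thesis
    by (metis eq_iff_diff_eq_0)
qed

section \<open>Adjoints through Riesz representation\<close>

lemma cadjoint_eqI:
  fixes T :: "'a::chilbert_space \<Rightarrow> 'b::chilbert_space"
  assumes "\<And>x y. cinner (T x) y = cinner x (T' y)"
  shows "cadjoint T = T'"
  unfolding cadjoint_def
proof (rule the_equality)
  fix T'' assume "\<forall>x y. cinner (T x) y = cinner x (T'' y)"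
  then show "T'' = T'"
    by (intro ext cinner_ext_right) (metis assms)
qed (use assms in blast)

text \<open>Riesz representation is the case of the identity with \<delta> = 1 in
  \<open>symmetric_lax_milgram\<close>. It only yields real parts; replacing \<open>x\<close> by
  \<open>\<i> *\<^sub>C x\<close> recovers the imaginary ones.\<close>

lemma cinner_cadjoint:
  fixes T :: "'a::chilbert_space \<Rightarrow> 'b::chilbert_space"
  assumes T: "bounded_clinear T"
  shows "cinner (T x) y = cinner x (cadjoint T y)"
proof -
  have "\<exists>w. \<forall>x. cinner (T x) y = cinner x w" for y
  proof -
    have "bounded_linear (\<lambda>x. inner (T x) y)"
      by (intro bounded_linear_compose[OF bounded_linear_inner_left] bounded_clinearD(8)[OF T])
    then obtain w where w: "\<And>x. inner (T x) y = inner w x"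
      using symmetric_lax_milgram[of "\<lambda>x. x" 1 "\<lambda>x. inner (T x) y"]
      by (auto simp: power2_norm_eq_inner)
    have "cinner (T x) y = cinner x w" for x
    proof (rule complex_eqI)
      show Re: "Re (cinner (T x) y) = Re (cinner x w)" for x
        using w[of x] by (simp add: inner_eq_Re_cinner[symmetric] inner_commute)
      show "Im (cinner (T x) y) = Im (cinner x w)"
        using Re[of "\<i> *\<^sub>C x"] by (simp add: bounded_clinearD[OF T] cinner_simps)
    qed
    then show ?thesis by blast
  qed
  then obtain T' where T': "\<And>x y. cinner (T x) y = cinner x (T' y)"
    by metis
  then show ?thesis
    using cadjoint_eqI[of T T'] by simp
qed

lemma cinner_cadjoint_left:
  assumes "bounded_clinear T"
  shows "cinner (cadjoint T y) x = cinner y (T x)"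
  by (metis assms cinner_cadjoint cinner_commute)

lemma norm_cadjoint_le:
  fixes T :: "'a::chilbert_space \<Rightarrow> 'b::chilbert_space"
  assumes T: "bounded_clinear T" and K: "K \<ge> 0" "\<And>x. norm (T x) \<le> K * norm x"
  shows "norm (cadjoint T y) \<le> K * norm y"
proof -
  have "(norm (cadjoint T y))\<^sup>2 = Re (cinner (T (cadjoint T y)) y)"
    by (simp add: cinner_cadjoint[OF T])
  also have "\<dots> \<le> norm (T (cadjoint T y)) * norm y"
    using Re_cinner_le by (rule abs_le_D1)
  also have "\<dots> \<le> K * norm (cadjoint T y) * norm y"
    by (intro mult_right_mono K) simp
  finally show ?thesis
    using K(1) by (cases "cadjoint T y = 0") (auto simp: power2_eq_square)
qed

lemma bounded_clinear_cadjoint: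
  assumes T: "bounded_clinear T"
  shows "bounded_clinear (cadjoint T)"
proof -
  obtain K where K: "K > 0" "\<And>x. norm (T x) \<le> K * norm x"
    using bounded_clinear_bound[OF T] by metis
  then have "norm (cadjoint T y) \<le> K * norm y" for y
    by (intro norm_cadjoint_le[OF T]) auto
  then show ?thesis
    by (rule bounded_clinearI[rotated 2])
      (rule cinner_ext_right, simp add: cinner_cadjoint[OF T, symmetric] cinner_simps)+
qed

lemma selfadjointD:
  assumes "selfadjoint A"
  shows "bounded_clinear A" "cinner (A x) y = cinner x (A y)"
  using assms cinner_cadjoint unfolding selfadjoint_def by metis+

lemma selfadjointI:
  assumes "bounded_clinear A" "\<And>x y. cinner (A x) y = cinner x (A y)"
  shows "selfadjoint A"
  using assms cadjoint_eqI unfolding selfadjoint_def by metis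

section \<open>Square roots and absolute values\<close>

text \<open>Taylor coefficients of (1 - t)^(1/2). The leading one is 1 and all others are
  nonpositive, on which both convergence at norm 1 and positivity of the root rest.\<close>

definition sqrt_coeff :: "nat \<Rightarrow> real" where
  "sqrt_coeff n = (-1) ^ n * ((1/2) gchoose n)"

text \<open>These are the Taylor coefficients of (1 - t)^(-1/2). They control those of (1 - t)^(1/2)
  twice: through the derivative, which fixes the signs, and through the partial sums.\<close>

lemma gbinomial_neg_half_sign: "0 \<le> (-1) ^ n * ((-1/2 :: real) gchoose n)"
proof -
  have "(-1) ^ n * (\<Prod>i=0..<n. -1/2 - real i) = (\<Prod>i=0..<n. 1/2 + real i)"
    by (induction n) (auto simp: algebra_simps)
  also have "\<dots> \<ge> 0" by (intro prod_nonneg) auto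
  finally show ?thesis
    by (simp add: gbinomial_prod_rev)
qed

lemma sqrt_coeff_0 [simp]: "sqrt_coeff 0 = 1"
  by (simp add: sqrt_coeff_def)

lemma sqrt_coeff_nonpos:
  assumes "n > 0"
  shows "sqrt_coeff n \<le> 0"
proof -
  obtain m where n: "n = Suc m" using assms by (cases n) auto
  have "real (Suc m) * ((1/2 :: real) gchoose Suc m) = 1/2 * ((-1/2) gchoose m)"
    using gbinomial_absorption[of m "1/2 :: real"] by simp
  then have "sqrt_coeff n = - (1/2 / real (Suc m)) * ((-1) ^ m * ((-1/2) gchoose m))"
    by (simp add: sqrt_coeff_def n field_simps)
  also have "\<dots> \<le> 0"
    using gbinomial_neg_half_sign[of m] by (intro mult_nonpos_nonneg) auto
  finally show ?thesis .
qed

text \<open>Partial sums are the coefficients after division by 1 - t, hence those of (1 -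
  t)^(-1/2).\<close>

lemma sqrt_coeff_sum_nonneg: "0 \<le> (\<Sum>k\<le>n. sqrt_coeff k)"
  using gbinomial_sum_lower_neg[of "1/2 :: real" n] gbinomial_neg_half_sign[of n]
  by (simp add: sqrt_coeff_def mult.commute)

lemma sqrt_coeff_abs_summable: "(\<lambda>n. \<bar>sqrt_coeff n\<bar>) summable_on UNIV"
proof -
  have "(\<Sum>k<n. \<bar>sqrt_coeff k\<bar>) \<le> 2" for n
  proof (cases n)
    case (Suc m)
    \<comment> \<open>Only the coefficient 1 at index 0 is positive; it is written as 2 - 1 so that
      all terms take the shape of a correction minus the coefficient.\<close>
    have "(\<Sum>k\<le>m. \<bar>sqrt_coeff k\<bar>) = (\<Sum>k\<le>m. (if k = 0 then 2 else 0) - sqrt_coeff k)"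
      by (intro sum.cong) (auto simp: sqrt_coeff_nonpos)
    also have "\<dots> = 2 - (\<Sum>k\<le>m. sqrt_coeff k)"
      by (simp add: sum_subtractf)
    finally show ?thesis
      using sqrt_coeff_sum_nonneg[of m] by (simp add: Suc lessThan_Suc_atMost)
  qed simp
  then have "summable (\<lambda>n. \<bar>sqrt_coeff n\<bar>)"
    by (intro summableI_nonneg_bounded) auto
  then show ?thesis
    by (intro norm_summable_imp_summable_on) simp
qed

text \<open>The square of the series is 1 - t, by Vandermonde's identity for 1/2 + 1/2 = 1.\<close>

lemma sqrt_coeff_convolution:
  "(\<Sum>k\<le>n. sqrt_coeff k * sqrt_coeff (n - k)) = (if n = 0 then 1 else if n = 1 then -1 else 0)"
proof -
  have "(\<Sum>k\<le>n. sqrt_coeff k * sqrt_coeff (n - k)) =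
      (\<Sum>k\<le>n. (-1) ^ n * (((1/2) gchoose k) * ((1/2) gchoose (n - k))))"
    by (intro sum.cong) (auto simp: sqrt_coeff_def simp flip: power_add)
  also have "\<dots> = (-1) ^ n * ((1/2 + 1/2) gchoose n)"
    by (simp only: sum_distrib_left[symmetric] atMost_atLeast0 gbinomial_Vandermonde)
  also have "((1/2 + 1/2 :: real) gchoose n) = of_nat (1 choose n)"
    by (simp add: binomial_gbinomial)
  finally show ?thesis
    by (cases n) (auto simp: binomial_eq_0)
qed

text \<open>The square root is the binomial series \<open>\<Sum>n. (-1)^n (1/2 choose n) B^n\<close>, which converges
  absolutely even for \<open>\<parallel>B\<parallel> = 1\<close>.\<close>

lemma sqrt_one_minus_contraction:
  fixes B :: "'a::chilbert_space \<Rightarrow> 'a"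
  assumes B: "selfadjoint B" and contr: "\<And>x. norm (B x) \<le> norm x"
  obtains D where "positive_op D" "\<And>x. D (D x) = x - B x"
    "\<And>F x. bounded_linear F \<Longrightarrow> (\<And>x. F (B x) = B (F x)) \<Longrightarrow> F (D x) = D (F x)"
proof -
  note lin = selfadjointD(1)[OF B]
  have pow: "bounded_clinear (B ^^ n)" for n
  proof (induction n)
    case (Suc n)
    then show ?case using bounded_clinear_compose[OF lin Suc] by (simp add: o_def)
  qed (simp add: bounded_clinear_ident id_def)
  have pow_le: "norm ((B ^^ n) x) \<le> norm x" for n x
    by (induction n) (auto intro: order_trans[OF contr])
  have pow_sym: "cinner ((B ^^ n) x) y = cinner x ((B ^^ n) y)" for n x y
    by (induction n arbitrary: x y) (simp_all add: selfadjointD(2)[OF B] funpow_swap1)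
  define D where "D x = (\<Sum>\<^sub>\<infinity>n. sqrt_coeff n *\<^sub>R (B ^^ n) x)" for x
  have abs_summable: "(\<lambda>n. sqrt_coeff n *\<^sub>R (B ^^ n) x) abs_summable_on UNIV" for x
    by (rule summable_on_comparison_test[OF
          summable_on_cmult_left[OF sqrt_coeff_abs_summable, of "norm x"]])
      (auto intro!: mult_left_mono pow_le)
  note summ = abs_summable_summable[OF abs_summable]
  have apply_lin: "F (D x) = (\<Sum>\<^sub>\<infinity>n. sqrt_coeff n *\<^sub>R F ((B ^^ n) x))"
    if "bounded_linear F" for F :: "'a \<Rightarrow> 'c::banach" and x
    unfolding D_def using infsumI[OF has_sum_bounded_linear[OF that has_sum_infsum[OF summ[of x]]]]
    by (simp add: o_def linear_simps[OF that])
  have D_lim: "(\<lambda>N. \<Sum>n\<le>N. sqrt_coeff n *\<^sub>R F ((B ^^ n) x)) \<longlonglongrightarrow> F (D x)"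
    if F: "bounded_linear F" for F :: "'a \<Rightarrow> 'c::banach" and x
  proof -
    have "((\<lambda>n. F (sqrt_coeff n *\<^sub>R (B ^^ n) x)) has_sum F (D x)) UNIV"
      unfolding D_def using has_sum_bounded_linear[OF F has_sum_infsum[OF summ[of x]]]
      by (simp add: o_def)
    then have "(\<lambda>n. sqrt_coeff n *\<^sub>R F ((B ^^ n) x)) sums F (D x)"
      using has_sum_imp_sums by (simp add: linear_simps[OF F])
    then show ?thesis by (simp add: sums_def_le)
  qed
  \<comment> \<open>This clause later gives uniqueness of the root and makes the defect operator
    respect a projection. It allows merely real-linear \<open>F\<close>, so that multiplication by a
    complex scalar is covered and \<open>D\<close> becomes complex-linear.\<close>
  have commute: "F (D x) = D (F x)"
    if F: "bounded_linear F" "\<And>x. F (B x) = B (F x)" for F x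
  proof -
    have "F ((B ^^ n) x) = (B ^^ n) (F x)" for n x
      by (induction n) (simp_all add: F(2))
    then show ?thesis
      unfolding apply_lin[OF F(1)] D_def[of "F x"] by simp
  qed
  have D_sym: "cinner (D x) y = cinner x (D y)" for x y
    unfolding apply_lin[OF bounded_linear_cinner_left] apply_lin[OF bounded_linear_cinner_right]
    by (simp add: pow_sym)
  have D_clin: "bounded_clinear D"
  proof (rule bounded_clinearI)
    show "D (x + y) = D x + D y" for x y
      unfolding D_def infsum_add[OF summ summ, symmetric]
      by (simp add: bounded_clinearD[OF pow] scaleR_add_right)
    show "D (c *\<^sub>C x) = c *\<^sub>C D x" for c x
      by (rule commute[symmetric])
        (simp_all add: bounded_clinearD[OF bounded_clinear_scaleC[OF bounded_clinear_ident]]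
          bounded_clinearD[OF lin])
    show "norm (D x) \<le> (\<Sum>\<^sub>\<infinity>n. \<bar>sqrt_coeff n\<bar>) * norm x" for x
    proof -
      have "norm (D x) \<le> (\<Sum>\<^sub>\<infinity>n. norm (sqrt_coeff n *\<^sub>R (B ^^ n) x))"
        unfolding D_def by (rule norm_infsum_bound[OF abs_summable])
      also have "\<dots> \<le> (\<Sum>\<^sub>\<infinity>n. \<bar>sqrt_coeff n\<bar> * norm x)"
        by (intro infsum_mono abs_summable summable_on_cmult_left sqrt_coeff_abs_summable)
          (auto intro!: mult_left_mono pow_le)
      finally show ?thesis
        by (simp add: infsum_cmult_left sqrt_coeff_abs_summable)
    qed
  qed
  \<comment> \<open>Replacing \<open>cinner ((B ^^ n) x) x\<close> by the larger
    \<open>(norm x)\<^sup>2\<close> lowers each term with nonpositive coefficient and keeps the term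
    at 0, so every partial sum dominates a nonnegative multiple of
    \<open>(norm x)\<^sup>2\<close>.\<close>
  have D_pos: "0 \<le> Re (cinner (D x) x)" for x
  proof (rule LIMSEQ_le_const)
    show "(\<lambda>N. \<Sum>n\<le>N. sqrt_coeff n *\<^sub>R Re (cinner ((B ^^ n) x) x)) \<longlonglongrightarrow> Re (cinner (D x) x)"
      using D_lim[OF bounded_linear_compose[OF bounded_linear_Re bounded_linear_cinner_left]] .
    have "0 \<le> (\<Sum>n\<le>N. sqrt_coeff n *\<^sub>R Re (cinner ((B ^^ n) x) x))" for N
    proof -
      have "0 \<le> (\<Sum>n\<le>N. sqrt_coeff n) * (norm x)\<^sup>2"
        by (intro mult_nonneg_nonneg sqrt_coeff_sum_nonneg) simp
      also have "\<dots> = (\<Sum>n\<le>N. sqrt_coeff n * (norm x)\<^sup>2)"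
        by (rule sum_distrib_right)
      also have "\<dots> \<le> (\<Sum>n\<le>N. sqrt_coeff n *\<^sub>R Re (cinner ((B ^^ n) x) x))"
      proof (rule sum_mono)
        fix n
        have "Re (cinner ((B ^^ n) x) x) \<le> norm ((B ^^ n) x) * norm x"
          using Re_cinner_le by (rule abs_le_D1)
        also have "\<dots> \<le> (norm x)\<^sup>2"
          unfolding power2_eq_square by (intro mult_right_mono pow_le) simp
        finally show "sqrt_coeff n * (norm x)\<^sup>2 \<le> sqrt_coeff n *\<^sub>R Re (cinner ((B ^^ n) x) x)"
          by (cases "n = 0") (auto intro!: mult_left_mono_neg sqrt_coeff_nonpos)
      qed
      finally show ?thesis .
    qed
    then show "\<exists>N. \<forall>n\<ge>N. 0 \<le> (\<Sum>n\<le>n. sqrt_coeff n *\<^sub>R Re (cinner ((B ^^ n) x) x))" by blast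
  qed
  have D_sq: "D (D x) = x - B x" for x
  proof -
    define f where "f = (\<lambda>(i, j). (sqrt_coeff i * sqrt_coeff j) *\<^sub>R (B ^^ (i + j)) x)"
    have "(\<lambda>(i, j). \<bar>sqrt_coeff i\<bar> * \<bar>sqrt_coeff j\<bar>) summable_on UNIV \<times> UNIV"
    proof (rule abs_summable_summable, rule iffD2[OF Infinite_Sum.abs_summable_on_Sigma_iff],
        intro conjI ballI)
      have *: "(\<lambda>j. norm (\<bar>sqrt_coeff i\<bar> * \<bar>sqrt_coeff j\<bar>)) = (\<lambda>j. \<bar>sqrt_coeff i\<bar> * \<bar>sqrt_coeff j\<bar>)"
        for i by simp
      show "(\<lambda>j. norm (case (i, j) of (i, j) \<Rightarrow> \<bar>sqrt_coeff i\<bar> * \<bar>sqrt_coeff j\<bar>)) summable_on UNIV" for i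
        unfolding prod.case * by (intro summable_on_cmult_right sqrt_coeff_abs_summable)
      show "(\<lambda>i. norm (\<Sum>\<^sub>\<infinity>j. norm (case (i, j) of (i, j) \<Rightarrow> \<bar>sqrt_coeff i\<bar> * \<bar>sqrt_coeff j\<bar>)))
          summable_on UNIV"
        unfolding prod.case * infsum_cmult_right'
        unfolding norm_mult real_norm_def abs_idempotent abs_mult
        by (intro summable_on_cmult_left sqrt_coeff_abs_summable)
    qed
    then have "f abs_summable_on UNIV \<times> UNIV"
      by (rule summable_on_comparison_test[OF summable_on_cmult_left[of _ _ "norm x"]])
        (auto simp: f_def abs_mult intro!: mult_left_mono pow_le)
    then have f: "f summable_on UNIV \<times> UNIV"
      by (rule abs_summable_summable)
    \<comment> \<open>Cauchy product: the absolutely summable double family is regrouped along the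
      diagonals of constant index sum.\<close>
    have bij: "bij_betw (\<lambda>(n, i). (i, n - i)) (Sigma UNIV (\<lambda>n::nat. {..n})) (UNIV \<times> UNIV)"
      by (rule bij_betwI[of _ _ _ "\<lambda>(i, j). (i + j, i)"]) auto
    have "D (D x) = (\<Sum>\<^sub>\<infinity>i. \<Sum>\<^sub>\<infinity>j. f (i, j))"
    proof -
      have "D (D x) = (\<Sum>\<^sub>\<infinity>i. sqrt_coeff i *\<^sub>R (B ^^ i) (D x))"
        by (simp add: D_def[of "D x"])
      also have "\<dots> = (\<Sum>\<^sub>\<infinity>i. \<Sum>\<^sub>\<infinity>j. f (i, j))"
      proof (rule infsum_cong)
        fix i
        have "bounded_linear (\<lambda>y. sqrt_coeff i *\<^sub>R (B ^^ i) y)"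
          by (intro bounded_linear_scaleR_right bounded_linear_compose[OF bounded_linear_scaleR_right]
              bounded_clinearD(8) pow)
        from apply_lin[OF this, of x]
        show "sqrt_coeff i *\<^sub>R (B ^^ i) (D x) = (\<Sum>\<^sub>\<infinity>j. f (i, j))"
          by (simp add: f_def funpow_add mult.commute)
      qed
      finally show ?thesis .
    qed
    also have "\<dots> = infsum f (UNIV \<times> UNIV)"
      by (rule infsum_Sigma_banach[OF f])
    also have "\<dots> = infsum (\<lambda>p. f ((\<lambda>(n, i). (i, n - i)) p)) (Sigma UNIV (\<lambda>n. {..n}))"
      by (rule infsum_reindex_bij_betw[OF bij, symmetric])
    also have "\<dots> = (\<Sum>\<^sub>\<infinity>n. \<Sum>\<^sub>\<infinity>i\<in>{..n}. f (i, n - i))"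
      using infsum_Sigma_banach[of "\<lambda>p. f ((\<lambda>(n, i). (i, n - i)) p)" UNIV "\<lambda>n. {..n}"] f
        summable_on_reindex_bij_betw[OF bij, of f] by simp
    also have "\<dots> = (\<Sum>\<^sub>\<infinity>n. (if n = 0 then 1 else if n = 1 then -1 else 0) *\<^sub>R (B ^^ n) x)"
      by (intro infsum_cong)
        (simp add: f_def scaleR_left.sum[symmetric] sqrt_coeff_convolution[symmetric] del: One_nat_def)
    also have "\<dots> = (\<Sum>\<^sub>\<infinity>n\<in>{0, 1}. (if n = 0 then 1 else if n = 1 then -1 else 0) *\<^sub>R (B ^^ n) x)"
      by (rule infsum_cong_neutral) auto
    also have "\<dots> = x - B x" by simp
    finally show ?thesis .
  qed
  show thesis
    by (rule that[of D])
      (auto simp: positive_op_def D_pos D_sq intro!: selfadjointI D_clin D_sym commute)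
qed

text \<open>A zero of a nonnegative form is a minimum, so the first variation vanishes; in the
  direction \<open>R y\<close> it equals \<open>2 * (norm (R y))\<^sup>2\<close>.\<close>

lemma positive_op_form_zero:
  assumes R: "positive_op R" and y: "Re (cinner (R y) y) = 0"
  shows "R y = 0"
proof -
  have R': "selfadjoint R" and pos: "\<And>x. 0 \<le> Re (cinner (R x) x)"
    using R by (auto simp: positive_op_def)
  note lin = bounded_clinearD[OF selfadjointD(1)[OF R']]
  have "2 * (norm (R y))\<^sup>2 = 0"
  proof (rule nonneg_quadratic_imp_zero)
    fix t :: real
    have "0 \<le> Re (cinner (R (y + t *\<^sub>R R y)) (y + t *\<^sub>R R y))"
      by (rule pos)
    also have "\<dots> = t * (2 * (norm (R y))\<^sup>2) + t\<^sup>2 * Re (cinner (R (R y)) (R y))"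
      using y selfadjointD(2)[OF R', of "R y" y]
      by (simp add: lin cinner_simps power2_eq_square algebra_simps)
    finally show "0 \<le> t * (2 * (norm (R y))\<^sup>2) + t\<^sup>2 * Re (cinner (R (R y)) (R y))" .
  qed
  then show ?thesis by simp
qed

text \<open>If \<open>R\<close> commutes with everything that commutes with \<open>R\<^sup>2\<close>, then it commutes with any other
  root \<open>R'\<close>, and \<open>(R - R')(R + R')(R - R') = 0\<close> splits into two nonnegative forms.\<close>

lemma positive_sqrt_unique:
  assumes R: "positive_op R" and R': "positive_op R'" and eq: "\<And>x. R' (R' x) = R (R x)"
    and commute: "\<And>F x. bounded_linear F \<Longrightarrow> (\<And>x. F (R (R x)) = R (R (F x))) \<Longrightarrow> F (R x) = R (F x)"
  shows "R' = R"
proof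
  fix x
  have sa: "selfadjoint R" "selfadjoint R'"
    using R R' by (auto simp: positive_op_def)
  note lin = bounded_clinearD[OF selfadjointD(1)[OF sa(1)]]
    bounded_clinearD[OF selfadjointD(1)[OF sa(2)]]
  have comm: "R' (R z) = R (R' z)" for z
    by (rule commute) (simp_all add: lin eq[symmetric])
  define y where "y = R x - R' x"
  have "R y + R' y = 0"
    by (simp add: y_def lin comm eq)
  then have "Re (cinner (R y) y) + Re (cinner (R' y) y) = 0"
    by (metis cinner_add_left cinner_zero_left plus_complex.simps(1) zero_complex.simps(1))
  moreover have "0 \<le> Re (cinner (R y) y)" "0 \<le> Re (cinner (R' y) y)"
    using R R' by (auto simp: positive_op_def)
  ultimately have "R y = 0" "R' y = 0"
    using positive_op_form_zero[OF R] positive_op_form_zero[OF R'] by auto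
  then have "cinner (R x - R' x) y = 0"
    by (simp add: cinner_diff_left selfadjointD(2)[OF sa(1)] selfadjointD(2)[OF sa(2)])
  then have "y = 0"
    using cinner_self[of y] by (simp add: y_def)
  then show "R' x = R x"
    by (simp add: y_def)
qed

text \<open>Scaling by a norm bound \<open>K\<close> makes B = 1 - T^* T / K^2 a contraction, so the
  root of 1 - B exists and \<open>K\<close> times it is a positive root of T^* T. Uniqueness then
  identifies it with the definite description.\<close>

lemma op_abs:
  fixes T :: "'a::chilbert_space \<Rightarrow> 'b::chilbert_space"
  assumes T: "bounded_clinear T"
  shows "positive_op (op_abs T)" and "op_abs T (op_abs T x) = cadjoint T (T x)"
proof -
  obtain K where K: "K > 0" "\<And>x. norm (T x) \<le> K * norm x"
    using bounded_clinear_bound[OF T] by metis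
  define A where "A x = cadjoint T (T x)" for x
  have A: "bounded_clinear A"
    unfolding A_def by (intro bounded_clinear_compose[OF bounded_clinear_cadjoint] T)
  have A_sym: "cinner (A x) y = cinner x (A y)" for x y
    by (simp add: A_def cinner_cadjoint[OF T, symmetric] cinner_cadjoint_left[OF T])
  define B where "B x = x - complex_of_real (1 / K\<^sup>2) *\<^sub>C A x" for x
  have B: "selfadjoint B"
    unfolding B_def
    by (intro selfadjointI bounded_clinear_diff bounded_clinear_ident bounded_clinear_scaleC A)
      (simp add: cinner_simps A_sym)
  have contr: "norm (B x) \<le> norm x" for x
  proof -
    have "(norm (A x))\<^sup>2 \<le> (K * norm (T x))\<^sup>2"
      unfolding A_def using K by (intro power_mono norm_cadjoint_le[OF T]) auto
    then have "(norm (A x))\<^sup>2 / K ^ 4 \<le> (norm (T x))\<^sup>2 / K\<^sup>2"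
      using K(1) by (simp add: field_simps power_mult_distrib eval_nat_numeral)
    moreover have "(norm (B x))\<^sup>2 = (norm x)\<^sup>2 - 2 * (norm (T x))\<^sup>2 / K\<^sup>2 + (norm (A x))\<^sup>2 / K ^ 4"
    proof -
      have "Re (cinner (A x) x) = (norm (T x))\<^sup>2" "Re (cinner x (A x)) = (norm (T x))\<^sup>2"
        by (simp_all add: A_def cinner_cadjoint_left[OF T] cinner_cadjoint[OF T, symmetric])
      then have "Re (cinner (B x) (B x)) =
          (norm x)\<^sup>2 - 2 * (norm (T x))\<^sup>2 / K\<^sup>2 + (norm (A x))\<^sup>2 / K ^ 4"
        unfolding B_def by (simp add: scaleR_scaleC[symmetric] cinner_simps)
          (use K(1) in \<open>simp add: field_simps eval_nat_numeral\<close>)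
      then show ?thesis by simp
    qed
    moreover have "0 \<le> (norm (T x))\<^sup>2 / K\<^sup>2" by simp
    ultimately have "(norm (B x))\<^sup>2 \<le> (norm x)\<^sup>2" by linarith
    then show ?thesis by (rule power2_le_imp_le) simp
  qed
  obtain D where D: "positive_op D" "\<And>x. D (D x) = x - B x"
    "\<And>F x. bounded_linear F \<Longrightarrow> (\<And>x. F (B x) = B (F x)) \<Longrightarrow> F (D x) = D (F x)"
    using sqrt_one_minus_contraction[OF B contr] by metis
  have D_lin: "bounded_clinear D" and D_sym: "\<And>x y. cinner (D x) y = cinner x (D y)"
    using D(1) selfadjointD by (auto simp: positive_op_def)
  define R where "R x = complex_of_real K *\<^sub>C D x" for x
  have R_clin: "bounded_clinear R"
    unfolding R_def by (intro bounded_clinear_scaleC D_lin)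
  have R: "positive_op R"
    unfolding positive_op_def
  proof (intro conjI allI selfadjointI R_clin)
    show "0 \<le> Re (cinner (R x) x)" for x
      using D(1) K(1) by (simp add: R_def cinner_simps positive_op_def)
  qed (simp add: R_def cinner_simps D_sym)
  have R_sq: "R (R x) = A x" for x
    using K(1) by (simp add: R_def bounded_clinearD[OF D_lin] D(2) B_def
        scaleC_scaleC scaleC_one power2_eq_square)
  have R_comm: "F (R x) = R (F x)"
    if F: "bounded_linear F" "\<And>x. F (A x) = A (F x)" for F x
  proof -
    have "F (B y) = B (F y)" for y
      by (simp only: B_def scaleR_scaleC[symmetric] linear_simps[OF F(1)] F(2))
    then show ?thesis
      using D(3)[OF F(1)] by (simp add: R_def scaleR_scaleC[symmetric] linear_simps[OF F(1)])
  qed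
  have "op_abs T = R"
    unfolding op_abs_def op_sqrt_def
  proof (rule the_equality)
    show "positive_op R \<and> R \<circ> R = cadjoint T \<circ> T"
      using R R_sq by (auto simp: A_def)
    fix R' assume "positive_op R' \<and> R' \<circ> R' = cadjoint T \<circ> T"
    then show "R' = R"
      by (intro positive_sqrt_unique R) (auto simp: R_sq A_def R_comm fun_eq_iff)
  qed
  then show "positive_op (op_abs T)" "op_abs T (op_abs T x) = cadjoint T (T x)"
    using R R_sq by (auto simp: A_def)
qed

lemma op_abs_selfadjoint: "bounded_clinear T \<Longrightarrow> selfadjoint (op_abs T)"
  by (metis op_abs(1) positive_op_def)

lemma cinner_op_abs:
  assumes T: "bounded_clinear T"
  shows "cinner (op_abs T x) (op_abs T y) = cinner (T x) (T y)"
  by (metis T cinner_cadjoint op_abs(2) op_abs_selfadjoint selfadjointD(2))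

lemma norm_op_abs:
  assumes T: "bounded_clinear T"
  shows "norm (op_abs T x) = norm (T x)"
  using cinner_op_abs[OF T, of x x] by (simp add: cinner_self power2_eq_iff_nonneg flip: of_real_power)

text \<open>An approximate polar decomposition, with \<open>U = T(|T| + \<delta>)\<inverse>\<close>.\<close>

lemma approximate_polar:
  fixes T :: "'a::chilbert_space \<Rightarrow> 'b::chilbert_space"
  assumes T: "bounded_clinear T" and \<delta>: "\<delta> > 0"
  obtains U where "bounded_clinear U" "\<And>x. norm (U x) \<le> norm x"
    "\<And>x. Re (cinner (op_abs T x) x) - \<delta> * (norm x)\<^sup>2 \<le> Re (cinner (T x) (U x))"
proof -
  define R where "R = op_abs T"
  have R: "bounded_clinear R" "\<And>x y. cinner (R x) y = cinner x (R y)"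
    "\<And>x. 0 \<le> Re (cinner (R x) x)"
    using op_abs(1)[OF T] selfadjointD unfolding R_def positive_op_def by metis+
  define Q where "Q x = R x + \<delta> *\<^sub>R x" for x
  have Q: "bounded_clinear Q"
    unfolding Q_def scaleR_scaleC
    by (intro bounded_clinear_add R bounded_clinear_scaleC bounded_clinear_ident)
  have coercive: "\<delta> * (norm x)\<^sup>2 \<le> inner (Q x) x" for x
    using R(3)[of x] by (simp add: Q_def inner_eq_Re_cinner cinner_simps)
  have "\<exists>p. Q p = y" for y
  proof -
    have "inner (Q x) z = inner x (Q z)" for x z
      using R(2)[of x z] by (simp add: Q_def inner_eq_Re_cinner cinner_simps)
    from symmetric_lax_milgram[OF bounded_clinearD(8)[OF Q] this coercive \<delta>
        bounded_linear_inner_right[of y]]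
    obtain p where "\<And>z. inner y z = inner (Q p) z" by blast
    then have "Q p = y" by (metis vector_eq_rdot)
    then show ?thesis ..
  qed
  then obtain p where p: "\<And>y. Q (p y) = y" by metis
  have Q_inj: "x = y" if "Q x = Q y" for x y
  proof -
    have "\<delta> * (norm (x - y))\<^sup>2 \<le> 0"
      using coercive[of "x - y"] that by (simp add: bounded_clinearD[OF Q])
    then show ?thesis using \<delta> by (simp add: mult_le_0_iff)
  qed
  have Rp: "R (p x) = x - \<delta> *\<^sub>R p x" for x
    using p[of x] by (simp add: Q_def eq_diff_eq)
  \<comment> \<open>Expanding the square of the norm of \<open>Q (p x)\<close> shows that the terms
    coming from \<delta> are nonnegative.\<close>
  have R_le: "norm (R (p x)) \<le> norm x" for x
  proof -
    have "(norm x)\<^sup>2 = Re (cinner (Q (p x)) (Q (p x)))"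
      by (simp add: p)
    also have "\<dots> = (norm (R (p x)))\<^sup>2 + 2 * \<delta> * Re (cinner (R (p x)) (p x)) + \<delta>\<^sup>2 * (norm (p x))\<^sup>2"
      using R(2)[of "p x" "p x"]
      by (simp add: Q_def cinner_simps power2_eq_square[of \<delta>] algebra_simps)
    finally have "(norm (R (p x)))\<^sup>2 \<le> (norm x)\<^sup>2"
      using \<delta> R(3)[of "p x"] by simp
    then show ?thesis by (rule power2_le_imp_le) simp
  qed
  show thesis
  proof (rule that[of "\<lambda>x. T (p x)"])
    show bound: "norm (T (p x)) \<le> norm x" for x
      using R_le[of x] norm_op_abs[OF T] by (simp add: R_def)
    have "p (x + y) = p x + p y" "p (c *\<^sub>C x) = c *\<^sub>C p x" for x y c
      by (rule Q_inj, simp add: bounded_clinearD[OF Q] p)+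
    then show "bounded_clinear (\<lambda>x. T (p x))"
      by (intro bounded_clinearI[where K = 1]) (simp_all add: bounded_clinearD[OF T] bound)
    fix x
    \<comment> \<open>This bounds the only loss, \<delta> <R x, p x>, which arises from R (p x) = x
      - \<delta> p x.\<close>
    have "Re (cinner x (R (p x))) \<le> norm x * norm (R (p x))"
      using Re_cinner_le by (rule abs_le_D1)
    also have "\<dots> \<le> (norm x)\<^sup>2"
      unfolding power2_eq_square by (intro mult_left_mono R_le) simp
    finally have "Re (cinner (R x) (p x)) \<le> (norm x)\<^sup>2"
      by (simp add: R(2))
    moreover have "Re (cinner (T x) (T (p x))) = Re (cinner (R x) x) - \<delta> * Re (cinner (R x) (p x))"
      by (simp add: cinner_op_abs[OF T, symmetric] R_def[symmetric] Rp cinner_simps)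
    ultimately show "Re (cinner (op_abs T x) x) - \<delta> * (norm x)\<^sup>2 \<le> Re (cinner (T x) (T (p x)))"
      using \<delta> by (simp add: R_def)
  qed
qed

section \<open>Orthonormal families and finite-dimensional subspaces\<close>

text \<open>Values from \<open>k\<close> on are arbitrary, so a family is extended by a function
  update and shortened by lowering \<open>k\<close>.\<close>

definition orthonormal :: "(nat \<Rightarrow> 'a::complex_inner) \<Rightarrow> nat \<Rightarrow> bool" where
  "orthonormal z k \<longleftrightarrow> (\<forall>i<k. \<forall>j<k. cinner (z i) (z j) = (if i = j then 1 else 0))"

lemma orthonormalD:
  assumes "orthonormal z k" "i < k" "j < k"
  shows "cinner (z i) (z j) = (if i = j then 1 else 0)"
  using assms by (simp add: orthonormal_def)

lemma orthonormal_norm: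
  assumes "orthonormal z k" "i < k"
  shows "norm (z i) = 1"
proof -
  have "complex_of_real ((norm (z i))\<^sup>2) = of_real 1"
    using orthonormalD[OF assms(1,2,2)] cinner_self[of "z i"] by simp
  then show ?thesis
    unfolding of_real_eq_iff by (simp add: power2_eq_1_iff) (smt (verit) norm_ge_zero)
qed

lemma cinner_unit:
  assumes "norm x = 1"
  shows "cinner x x = 1"
  using assms by (simp add: cinner_self)

lemma orthonormal_extend:
  assumes z: "orthonormal z n" and x: "norm x = 1" "\<And>i. i < n \<Longrightarrow> cinner x (z i) = 0"
  shows "orthonormal (z(n := x)) (Suc n)"
proof -
  have "cinner (z i) x = 0" if "i < n" for i
    using x(2)[OF that] cinner_commute[of "z i" x] by simp
  then show ?thesis
    using z x cinner_unit[OF x(1)] by (auto simp: orthonormal_def less_Suc_eq)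
qed

lemma orthonormal_coeff:
  assumes "orthonormal z k" "i < k"
  shows "cinner (\<Sum>j<k. c j *\<^sub>C z j) (z i) = c i"
proof -
  have "cinner (\<Sum>j<k. c j *\<^sub>C z j) (z i) = (\<Sum>j<k. if j = i then c j else 0)"
    unfolding cinner_sum_left
    using assms by (intro sum.cong) (auto simp: cinner_simps orthonormalD)
  then show ?thesis using assms(2) by simp
qed

lemma orthonormal_parseval:
  assumes "orthonormal z k"
  shows "cinner (\<Sum>j<k. c j *\<^sub>C z j) (\<Sum>j<k. d j *\<^sub>C z j) = (\<Sum>j<k. c j * cnj (d j))"
  unfolding cinner_sum_right[of "\<Sum>j<k. c j *\<^sub>C z j"] cinner_scaleC_right
  by (intro sum.cong) (auto simp: orthonormal_coeff[OF assms] mult.commute)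

lemma orthonormal_inj:
  assumes "orthonormal z k"
  shows "inj_on z {..<k}"
  by (rule inj_onI) (metis assms lessThan_iff orthonormalD zero_neq_one)

lemma orthonormal_has_cdim:
  assumes z: "orthonormal z k"
  shows "has_cdim (cspan (z ` {..<k})) k"
proof -
  have "\<not> cdependent (z ` {..<k})"
  proof (rule complex_vector.independent_if_scalars_zero)
    fix f x assume "(\<Sum>x\<in>z ` {..<k}. f x *\<^sub>C x) = 0" and x: "x \<in> z ` {..<k}"
    then have "(\<Sum>j<k. f (z j) *\<^sub>C z j) = 0"
      by (simp add: sum.reindex[OF orthonormal_inj[OF z]])
    with x show "f x = 0"
      using orthonormal_coeff[OF z, of _ "\<lambda>j. f (z j)"] by auto
  qed simp
  then show ?thesis
    unfolding has_cdim_def using card_image[OF orthonormal_inj[OF z]]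
    by (intro exI[of _ "z ` {..<k}"]) simp
qed

lemma orthonormal_expansion:
  assumes z: "orthonormal z k" and x: "x \<in> cspan (z ` {..<k})"
  shows "x = (\<Sum>j<k. cinner x (z j) *\<^sub>C z j)"
  using x
proof (induction rule: complex_vector.span_induct_alt)
  case base
  show ?case by simp
next
  case (step c x y)
  then obtain i where i: "i < k" "x = z i" by auto
  have "(\<Sum>j<k. cinner x (z j) *\<^sub>C z j) = (\<Sum>j<k. if j = i then x else 0)"
    using i by (intro sum.cong) (auto simp: orthonormalD[OF z] scaleC_one)
  then have "(\<Sum>j<k. cinner x (z j) *\<^sub>C z j) = x"
    using i by simp
  moreover have "(\<Sum>j<k. cinner (c *\<^sub>C x + y) (z j) *\<^sub>C z j) =
      c *\<^sub>C (\<Sum>j<k. cinner x (z j) *\<^sub>C z j) + (\<Sum>j<k. cinner y (z j) *\<^sub>C z j)"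
    by (simp add: cinner_simps scaleC_add_left sum.distrib complex_vector.scale_sum_right
        scaleC_scaleC)
  ultimately show ?case
    using step(2) by metis
qed

lemma sum_scaleC_in_cspan: "(\<Sum>j\<in>I. c j *\<^sub>C z j) \<in> cspan (z ` I)"
  by (intro complex_vector.span_sum complex_vector.span_scale complex_vector.span_base) auto

lemma ortho_compl_cspan_iff: "x \<in> ortho_compl (cspan S) \<longleftrightarrow> (\<forall>y\<in>S. cinner x y = 0)"
proof safe
  fix y assume "x \<in> ortho_compl (cspan S)" "y \<in> S"
  then show "cinner x y = 0"
    by (auto simp: ortho_compl_def intro: complex_vector.span_base)
next
  assume S: "\<forall>y\<in>S. cinner x y = 0"
  have "cinner x y = 0" if "y \<in> cspan S" for y
    using that by (induction rule: complex_vector.span_induct_alt)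
      (use S in \<open>auto simp: cinner_simps\<close>)
  then show "x \<in> ortho_compl (cspan S)"
    by (simp add: ortho_compl_def)
qed

text \<open>Gaussian elimination: an equation with a nonzero coefficient at \<open>p\<close> removes
  the unknown \<open>p\<close> from the others, and back substitution determines
  \<open>d p\<close>.\<close>

lemma homogeneous_system_nontrivial:
  fixes a :: "'l \<Rightarrow> 'j \<Rightarrow> 'f::field"
  assumes "finite L" "finite J" "card L < card J"
  shows "\<exists>c. (\<exists>j\<in>J. c j \<noteq> 0) \<and> (\<forall>l\<in>L. (\<Sum>j\<in>J. a l j * c j) = 0)"
  using assms
proof (induction L arbitrary: a J rule: finite_induct)
  case empty
  then have "J \<noteq> {}" by auto
  then show ?case by (intro exI[of _ "\<lambda>_. 1"]) auto
next
  case (insert l L)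
  show ?case
  proof (cases "\<forall>j\<in>J. a l j = 0")
    case True
    obtain c where "\<exists>j\<in>J. c j \<noteq> 0" "\<forall>l\<in>L. (\<Sum>j\<in>J. a l j * c j) = 0"
      using insert.IH[of J a] insert.prems insert.hyps by auto
    then show ?thesis
      using True by (intro exI[of _ c]) auto
  next
    case False
    then obtain p where p: "p \<in> J" "a l p \<noteq> 0" by auto
    define J' where "J' = J - {p}"
    have J: "J = insert p J'" "p \<notin> J'" "finite J'"
      using p insert.prems by (auto simp: J'_def)
    have "card L < card J'"
      using insert.prems insert.hyps J by simp
    then obtain c where c: "\<exists>j\<in>J'. c j \<noteq> 0"
      "\<And>l'. l' \<in> L \<Longrightarrow> (\<Sum>j\<in>J'. (a l' j - a l' p * a l j / a l p) * c j) = 0"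
      using insert.IH[of J' "\<lambda>l' j. a l' j - a l' p * a l j / a l p"] J by auto
    define d where "d = c(p := - (\<Sum>j\<in>J'. a l j * c j) / a l p)"
    have d: "(\<Sum>j\<in>J. a l' j * d j) = (\<Sum>j\<in>J'. (a l' j - a l' p * a l j / a l p) * c j)" for l'
    proof -
      have "(\<Sum>j\<in>J'. a l' j * d j) = (\<Sum>j\<in>J'. a l' j * c j)"
        using J by (intro sum.cong) (auto simp: d_def)
      then have "(\<Sum>j\<in>J. a l' j * d j) = (\<Sum>j\<in>J'. a l' j * c j) - a l' p / a l p * (\<Sum>j\<in>J'. a l j * c j)"
        using J by (simp add: d_def)
      then show ?thesis
        by (simp add: algebra_simps sum_subtractf sum_distrib_left)
    qed
    have "(\<Sum>j\<in>J. a l j * d j) = 0"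
      unfolding d using p by simp
    moreover have "\<exists>j\<in>J. d j \<noteq> 0"
      using c(1) J by (auto simp: d_def)
    ultimately show ?thesis
      using d c(2) by (intro exI[of _ d]) auto
  qed
qed

text \<open>Orthogonality to a basis of \<open>V\<close> amounts to \<open>n\<close> linear
  equations for \<open>m\<close> coefficients. This is the dimension count behind all later
  existence arguments.\<close>

lemma unit_vector_in_ortho_compl:
  assumes V: "has_cdim V n" and z: "orthonormal z m" and "n < m"
  obtains x where "x \<in> cspan (z ` {..<m})" "norm x = 1" "x \<in> ortho_compl V"
proof -
  obtain B where B: "finite B" "card B = n" "cspan B = V"
    using V by (auto simp: has_cdim_def)
  obtain c where c: "\<exists>j\<in>{..<m}. c j \<noteq> 0" "\<forall>b\<in>B. (\<Sum>j\<in>{..<m}. cinner (z j) b * c j) = 0"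
    using homogeneous_system_nontrivial[OF B(1), of "{..<m}" "\<lambda>b j. cinner (z j) b"] B \<open>n < m\<close>
    by auto
  define x where "x = (\<Sum>j<m. c j *\<^sub>C z j)"
  have x: "x \<in> cspan (z ` {..<m})"
    unfolding x_def by (rule sum_scaleC_in_cspan)
  have "x \<noteq> 0"
    using c(1) orthonormal_coeff[OF z, of _ c] unfolding x_def by auto
  have orth: "cinner x b = 0" if "b \<in> B" for b
    using c(2) that by (simp add: x_def cinner_sum_left cinner_simps mult.commute)
  show thesis
  proof (rule that[of "complex_of_real (1 / norm x) *\<^sub>C x"])
    show "complex_of_real (1 / norm x) *\<^sub>C x \<in> cspan (z ` {..<m})"
      by (rule complex_vector.span_scale[OF x])
    show "complex_of_real (1 / norm x) *\<^sub>C x \<in> ortho_compl V"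
      unfolding B(3)[symmetric] ortho_compl_cspan_iff by (simp add: cinner_simps orth)
  qed (use \<open>x \<noteq> 0\<close> in \<open>simp add: norm_scaleC norm_divide\<close>)
qed

text \<open>A nonzero remainder would enlarge \<open>w\<close> to \<open>Suc k\<close> orthonormal
  vectors in a space of dimension \<open>k\<close>; the dimension count then gives a unit vector
  orthogonal to itself.\<close>

lemma orthonormal_complete:
  assumes z: "orthonormal z k" and w: "orthonormal w k"
    and w_span: "\<And>i. i < k \<Longrightarrow> w i \<in> cspan (z ` {..<k})" and y: "y \<in> cspan (z ` {..<k})"
  shows "y = (\<Sum>i<k. cinner y (w i) *\<^sub>C w i)"
proof (rule ccontr)
  define r where "r = y - (\<Sum>i<k. cinner y (w i) *\<^sub>C w i)"
  assume "y \<noteq> (\<Sum>i<k. cinner y (w i) *\<^sub>C w i)"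
  then have r0: "r \<noteq> 0" by (simp add: r_def)
  define u where "u = complex_of_real (1 / norm r) *\<^sub>C r"
  have "r \<in> cspan (z ` {..<k})"
    unfolding r_def
    by (intro complex_vector.span_diff complex_vector.span_sum complex_vector.span_scale y)
      (auto intro: w_span)
  then have u: "u \<in> cspan (z ` {..<k})"
    unfolding u_def by (rule complex_vector.span_scale)
  have "orthonormal (w(k := u)) (Suc k)"
    using r0 by (intro orthonormal_extend w)
      (auto simp: u_def r_def cinner_simps orthonormal_coeff[OF w] norm_scaleC norm_divide)
  then obtain x where x: "x \<in> cspan ((w(k := u)) ` {..<Suc k})" "norm x = 1"
    "x \<in> ortho_compl (cspan (z ` {..<k}))"
    using unit_vector_in_ortho_compl[OF orthonormal_has_cdim[OF z]] by blast
  have "(w(k := u)) ` {..<Suc k} \<subseteq> cspan (z ` {..<k})"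
    using w_span u by (auto simp: less_Suc_eq)
  then have "x \<in> cspan (z ` {..<k})"
    using x(1) complex_vector.span_minimal complex_vector.subspace_span by blast
  then have "cinner x x = 0"
    using x(3) by (simp add: ortho_compl_def)
  then show False
    using cinner_unit[OF x(2)] by simp
qed

text \<open>Expand \<open>w i\<close> in the \<open>z j\<close>, exchange the sums, and reassemble
  each \<open>z j\<close> by completeness of \<open>w\<close>.\<close>

lemma trace_orthonormal_invariant:
  assumes B: "bounded_clinear B"
    and z: "orthonormal z k" and w: "orthonormal w k"
    and w_span: "\<And>i. i < k \<Longrightarrow> w i \<in> cspan (z ` {..<k})"
  shows "(\<Sum>i<k. cinner (B (w i)) (w i)) = (\<Sum>j<k. cinner (B (z j)) (z j))"
proof -
  have "(\<Sum>i<k. cinner (B (w i)) (w i)) = (\<Sum>i<k. \<Sum>j<k. cinner (w i) (z j) * cinner (B (z j)) (w i))"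
  proof (rule sum.cong[OF refl])
    fix i assume "i \<in> {..<k}"
    then have "B (w i) = B (\<Sum>j<k. cinner (w i) (z j) *\<^sub>C z j)"
      using orthonormal_expansion[OF z w_span] by simp
    then show "cinner (B (w i)) (w i) = (\<Sum>j<k. cinner (w i) (z j) * cinner (B (z j)) (w i))"
      by (simp add: bounded_clinearD[OF B] cinner_sum_left cinner_simps)
  qed
  also have "\<dots> = (\<Sum>j<k. cinner (B (z j)) (\<Sum>i<k. cinner (z j) (w i) *\<^sub>C w i))"
    by (subst sum.swap) (simp add: cinner_sum_right cinner_simps cinner_commute[symmetric])
  also have "\<dots> = (\<Sum>j<k. cinner (B (z j)) (z j))"
    by (intro sum.cong refl arg_cong2[where f = cinner] orthonormal_complete[OF z w w_span, symmetric])
      (auto intro: complex_vector.span_base)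
  finally show ?thesis .
qed

text \<open>Puts a prescribed unit vector last, so that an induction on the length can split it
  off.\<close>

lemma orthonormal_adapted:
  assumes z: "orthonormal z (Suc k)" and x: "x \<in> cspan (z ` {..<Suc k})" "norm x = 1"
  obtains w where "orthonormal w (Suc k)" "w k = x" "\<And>i. i < Suc k \<Longrightarrow> w i \<in> cspan (z ` {..<Suc k})"
proof -
  have "\<exists>w. orthonormal w n \<and> (\<forall>i<n. w i \<in> cspan (z ` {..<Suc k}) \<and> cinner x (w i) = 0)"
    if "n \<le> k" for n
    using that
  proof (induction n)
    case 0
    then show ?case by (auto simp: orthonormal_def)
  next
    case (Suc n)
    then obtain w where w: "orthonormal w n"
      "\<And>i. i < n \<Longrightarrow> w i \<in> cspan (z ` {..<Suc k})" "\<And>i. i < n \<Longrightarrow> cinner x (w i) = 0"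
      by auto
    \<comment> \<open>The slot \<open>n\<close> holds \<open>x\<close> only for the choice of
      \<open>y\<close>, which must avoid \<open>x\<close> as well; these are \<open>Suc n\<close>
      conditions in dimension \<open>Suc k\<close>, solvable because n < k. Afterwards
      \<open>y\<close> takes the slot.\<close>
    have "orthonormal (w(n := x)) (Suc n)"
      by (rule orthonormal_extend) (use w x in auto)
    then obtain y where y: "y \<in> cspan (z ` {..<Suc k})" "norm y = 1"
      "y \<in> ortho_compl (cspan ((w(n := x)) ` {..<Suc n}))"
      using unit_vector_in_ortho_compl[OF orthonormal_has_cdim z, of _ "Suc n"] Suc.prems
      by (metis Suc_le_lessD not_less_eq Suc_less_eq)
    have y': "cinner y x = 0" "cinner y (w i) = 0" if "i < n" for i
      using y(3) that unfolding ortho_compl_cspan_iff by (fastforce simp: lessThan_Suc)+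
    have "cinner y x = 0"
      using y(3) unfolding ortho_compl_cspan_iff by (fastforce simp: lessThan_Suc)
    then have "cinner x y = 0"
      using cinner_commute[of x y] by simp
    then have "\<forall>i<Suc n. (w(n := y)) i \<in> cspan (z ` {..<Suc k}) \<and> cinner x ((w(n := y)) i) = 0"
      using w y(1) by (auto simp: less_Suc_eq)
    with orthonormal_extend[OF w(1) y(2) y'(2)] show ?case
      by blast
  qed
  then obtain w where w: "orthonormal w k"
    "\<And>i. i < k \<Longrightarrow> w i \<in> cspan (z ` {..<Suc k})" "\<And>i. i < k \<Longrightarrow> cinner x (w i) = 0"
    by blast
  show thesis
    by (rule that[of "w(k := x)"]) (use w x in \<open>auto simp: less_Suc_eq intro!: orthonormal_extend\<close>)
qed

text \<open>A finite span never exhausts \<open>N\<close>, so a Gram-Schmidt remainder is always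
  left to normalize.\<close>

lemma infinite_cdim_orthonormal:
  assumes inf: "infinite_cdim N" and N: "complex_vector.subspace N"
  obtains z where "orthonormal z k" "\<And>i. i < k \<Longrightarrow> z i \<in> N"
proof -
  have "\<exists>z. orthonormal z k \<and> (\<forall>i<k. z i \<in> N)"
  proof (induction k)
    case 0
    then show ?case by (simp add: orthonormal_def)
  next
    case (Suc k)
    then obtain z where z: "orthonormal z k" "\<And>i. i < k \<Longrightarrow> z i \<in> N" by auto
    have "cspan (z ` {..<k}) \<subseteq> N"
      using z(2) N by (intro complex_vector.span_minimal) auto
    moreover have "cspan (z ` {..<k}) \<noteq> N"
      using orthonormal_has_cdim[OF z(1)] inf by (auto simp: infinite_cdim_def)
    ultimately obtain y where y: "y \<in> N" "y \<notin> cspan (z ` {..<k})" by auto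
    define r where "r = y - (\<Sum>i<k. cinner y (z i) *\<^sub>C z i)"
    have "r \<noteq> 0"
      using y(2) sum_scaleC_in_cspan[of "\<lambda>i. cinner y (z i)" z "{..<k}"] by (auto simp: r_def)
    have "r \<in> N"
      unfolding r_def using y(1) z(2) N
      by (intro complex_vector.subspace_diff complex_vector.subspace_sum complex_vector.subspace_scale)
        auto
    have "orthonormal (z(k := complex_of_real (1 / norm r) *\<^sub>C r)) (Suc k)"
      using \<open>r \<noteq> 0\<close> by (intro orthonormal_extend z)
        (auto simp: r_def cinner_simps orthonormal_coeff[OF z(1)] norm_scaleC norm_divide)
    moreover have "\<forall>i<Suc k. (z(k := complex_of_real (1 / norm r) *\<^sub>C r)) i \<in> N"
      using z(2) complex_vector.subspace_scale[OF N \<open>r \<in> N\<close>] by (auto simp: less_Suc_eq)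
    ultimately show ?case
      by blast
  qed
  then show thesis using that by blast
qed

section \<open>The spectral scale and Ky Fan's inequality\<close>

abbreviation form_sup :: "('a::chilbert_space \<Rightarrow> 'a) \<Rightarrow> 'a set \<Rightarrow> real" where
  "form_sup B V \<equiv> SUP x\<in>{x \<in> ortho_compl V. norm x = 1}. Re (cinner (B x) x)"

lemma spectral_scale_Suc:
  "spectral_scale B (int (Suc n)) = (INF V\<in>{V. has_cdim V n}. form_sup B V)"
  unfolding spectral_scale_def by (simp del: of_nat_Suc)

text \<open>Transfers all facts about the upper scale to the lower one.\<close>

lemma spectral_scale_neg:
  "spectral_scale B (- int (Suc n)) = - spectral_scale (\<lambda>x. - B x) (int (Suc n))"
proof -
  have *: "Re (cinner (- B x) x) = - Re (cinner (B x) x)" for x by simp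
  show ?thesis
    unfolding spectral_scale_def Inf_real_def * by (simp add: image_image del: of_nat_Suc)
qed

lemma form_bounded:
  assumes "bounded_clinear B"
  obtains K where "\<And>x. norm x = 1 \<Longrightarrow> \<bar>Re (cinner (B x) x)\<bar> \<le> K"
proof -
  obtain K where "\<And>x. norm (B x) \<le> K * norm x"
    using bounded_clinear_bound[OF assms] by metis
  then have "\<bar>Re (cinner (B x) x)\<bar> \<le> K" if "norm x = 1" for x
    using Re_cinner_le[of "B x" x] that by (metis mult.right_neutral order_trans)
  then show thesis using that by blast
qed

context
  fixes B :: "'a::chilbert_space \<Rightarrow> 'a" and K :: real
  assumes form: "\<And>x. norm x = 1 \<Longrightarrow> \<bar>Re (cinner (B x) x)\<bar> \<le> K"
begin

lemma form_sup_upper: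
  assumes "x \<in> ortho_compl V" "norm x = 1"
  shows "Re (cinner (B x) x) \<le> form_sup B V"
proof (rule cSUP_upper)
  show "bdd_above ((\<lambda>x. Re (cinner (B x) x)) ` {x \<in> ortho_compl V. norm x = 1})"
    using form by (intro bdd_aboveI2[of _ _ K]) (auto simp: abs_le_iff)
qed (use assms in simp)

text \<open>The family \<open>z\<close>, longer than the dimension of \<open>V\<close>, guarantees a
  unit vector orthogonal to \<open>V\<close>; a real supremum over the empty set would carry no
  information.\<close>

lemma form_sup_mono:
  assumes "has_cdim V n" "orthonormal (z :: nat \<Rightarrow> 'a) m" "n < m" "ortho_compl V \<subseteq> ortho_compl W"
  shows "form_sup B V \<le> form_sup B W"
proof (rule cSUP_least)
  obtain x where "norm x = 1" "x \<in> ortho_compl V"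
    using unit_vector_in_ortho_compl[OF assms(1-3)] by blast
  then show "{x \<in> ortho_compl V. norm x = 1} \<noteq> {}" by blast
qed (use assms(4) in \<open>auto intro: form_sup_upper\<close>)

lemma form_sup_bounds:
  assumes "has_cdim V n" "orthonormal (z :: nat \<Rightarrow> 'a) m" "n < m"
  shows "- K \<le> form_sup B V" "form_sup B V \<le> K"
proof -
  obtain x where x: "norm x = 1" "x \<in> ortho_compl V"
    using unit_vector_in_ortho_compl[OF assms] by blast
  show "- K \<le> form_sup B V"
    using form[OF x(1)] form_sup_upper[OF x(2,1)] by linarith
  show "form_sup B V \<le> K"
    by (rule cSUP_least) (use x form in \<open>auto simp: abs_le_iff\<close>)
qed

lemma spectral_scale_le_form_sup:
  assumes "has_cdim V n" "orthonormal (z :: nat \<Rightarrow> 'a) (Suc n)"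
  shows "spectral_scale B (int (Suc n)) \<le> form_sup B V"
  unfolding spectral_scale_Suc
proof (rule cINF_lower)
  show "bdd_below (form_sup B ` {V. has_cdim V n})"
    using form_sup_bounds(1)[OF _ assms(2)] by (intro bdd_belowI2[of _ "- K"]) auto
qed (use assms in simp)

lemma abs_spectral_scale_le:
  assumes z: "orthonormal (z :: nat \<Rightarrow> 'a) (Suc n)"
  shows "\<bar>spectral_scale B (int (Suc n))\<bar> \<le> K"
proof -
  have V: "has_cdim (cspan (z ` {..<n})) n"
    using z by (intro orthonormal_has_cdim) (auto simp: orthonormal_def)
  have "spectral_scale B (int (Suc n)) \<le> K"
    using spectral_scale_le_form_sup[OF V z] form_sup_bounds(2)[OF V z] by simp
  moreover have "- K \<le> spectral_scale B (int (Suc n))"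
    unfolding spectral_scale_Suc using V
    by (intro cINF_greatest) (auto intro: form_sup_bounds(1)[OF _ z])
  ultimately show ?thesis by linarith
qed

text \<open>Enlarging a competitor \<open>V\<close> by a unit vector of its complement leaves fewer
  test vectors, so the supremum does not grow.\<close>

lemma spectral_scale_Suc_le:
  assumes z: "orthonormal (z :: nat \<Rightarrow> 'a) (Suc (Suc n))"
  shows "spectral_scale B (int (Suc (Suc n))) \<le> spectral_scale B (int (Suc n))"
  unfolding spectral_scale_Suc[of B n]
proof (rule cINF_greatest)
  have "has_cdim (cspan (z ` {..<n})) n"
    using z by (intro orthonormal_has_cdim) (auto simp: orthonormal_def)
  then show "{V :: 'a set. has_cdim V n} \<noteq> {}" by blast
  fix V :: "'a set" assume "V \<in> {V. has_cdim V n}"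
  then have V: "has_cdim V n" by simp
  then obtain S where S: "finite S" "card S = n" "\<not> cdependent S" "cspan S = V"
    by (auto simp: has_cdim_def)
  obtain x where x: "norm x = 1" "x \<in> ortho_compl V"
    using unit_vector_in_ortho_compl[OF V z] by auto
  have "x \<notin> V"
    using x cinner_unit[OF x(1)] by (auto simp: ortho_compl_def)
  moreover have "S \<subseteq> V"
    unfolding S(4)[symmetric] by (rule complex_vector.span_superset)
  ultimately have "has_cdim (cspan (insert x S)) (Suc n)"
    unfolding has_cdim_def using S
    by (intro exI[of _ "insert x S"]) (auto simp: complex_vector.independent_insert)
  moreover have "ortho_compl (cspan (insert x S)) \<subseteq> ortho_compl V"
    unfolding S(4)[symmetric] ortho_compl_cspan_iff subset_iff by simp
  ultimately show "spectral_scale B (int (Suc (Suc n))) \<le> form_sup B V"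
    using spectral_scale_le_form_sup[OF _ z] form_sup_mono[OF _ z] by (meson lessI order_trans)
qed

text \<open>Peel off a unit vector of the span that is orthogonal to a nearly optimal subspace of
  dimension \<open>k\<close>; by invariance of the trace no diagonalization is needed.\<close>

lemma ky_fan:
  assumes B: "bounded_clinear B" and z: "orthonormal z k"
  shows "(\<Sum>i<k. Re (cinner (B (z i)) (z i))) \<le> (\<Sum>n<k. spectral_scale B (int (Suc n)))"
  using z
proof (induction k arbitrary: z)
  case (Suc k)
  show ?case
  proof (rule field_le_epsilon)
    fix e :: real assume "e > 0"
    have "orthonormal z k"
      using Suc.prems by (auto simp: orthonormal_def)
    from orthonormal_has_cdim[OF this] have "{V :: 'a set. has_cdim V k} \<noteq> {}" by blast
    then have "\<exists>s\<in>form_sup B ` {V. has_cdim V k}. s < spectral_scale B (int (Suc k)) + e"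
      using \<open>e > 0\<close> by (intro cInf_lessD) (simp_all add: spectral_scale_Suc del: of_nat_Suc)
    then obtain V where V: "has_cdim V k" "form_sup B V < spectral_scale B (int (Suc k)) + e"
      by blast
    obtain x where x: "x \<in> cspan (z ` {..<Suc k})" "norm x = 1" "x \<in> ortho_compl V"
      using unit_vector_in_ortho_compl[OF V(1) Suc.prems] by auto
    obtain w where w: "orthonormal w (Suc k)" "w k = x"
      "\<And>i. i < Suc k \<Longrightarrow> w i \<in> cspan (z ` {..<Suc k})"
      using orthonormal_adapted[OF Suc.prems x(1,2)] by metis
    have "(\<Sum>i<Suc k. Re (cinner (B (z i)) (z i))) = (\<Sum>i<Suc k. Re (cinner (B (w i)) (w i)))"
      using arg_cong[OF trace_orthonormal_invariant[OF B Suc.prems w(1,3)], of Re]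
      by (simp only: Re_sum)
    also have "\<dots> = (\<Sum>i<k. Re (cinner (B (w i)) (w i))) + Re (cinner (B x) x)"
      by (simp add: w(2))
    also have "\<dots> \<le> (\<Sum>n<k. spectral_scale B (int (Suc n))) + (spectral_scale B (int (Suc k)) + e)"
    proof (rule add_mono)
      \<comment> \<open>The first \<open>k\<close> vectors fall under the induction hypothesis
        without loss; only \<open>x\<close>, tested against the nearly optimal \<open>V\<close>,
        costs \<open>e\<close>.\<close>
      have "orthonormal w k"
        using w(1) by (auto simp: orthonormal_def)
      then show "(\<Sum>i<k. Re (cinner (B (w i)) (w i))) \<le> (\<Sum>n<k. spectral_scale B (int (Suc n)))"
        by (rule Suc.IH)
      show "Re (cinner (B x) x) \<le> spectral_scale B (int (Suc k)) + e"
        using form_sup_upper[OF x(3,2)] V(2) by linarith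
    qed
    finally show "(\<Sum>i<Suc k. Re (cinner (B (z i)) (z i)))
        \<le> (\<Sum>n<Suc k. spectral_scale B (int (Suc n))) + e"
      by simp
  qed
qed simp

text \<open>Greedy choice: the span of the vectors already found is a competitor in the infimum, so
  some unit vector orthogonal to it has a form value above the scale minus \<open>e\<close>.\<close>

lemma spectral_scale_nearly_attained:
  assumes inf: "infinite_cdim (UNIV :: 'a set)" and e: "e > 0"
  obtains x where "orthonormal x k"
    "\<And>i. i < k \<Longrightarrow> spectral_scale B (int (Suc i)) - e \<le> Re (cinner (B (x i)) (x i))"
proof -
  have "\<exists>x. orthonormal x k \<and>
      (\<forall>i<k. spectral_scale B (int (Suc i)) - e \<le> Re (cinner (B (x i)) (x i)))"
  proof (induction k)
    case 0
    show ?case by (simp add: orthonormal_def)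
  next
    case (Suc k)
    then obtain x where x: "orthonormal x k"
      "\<And>i. i < k \<Longrightarrow> spectral_scale B (int (Suc i)) - e \<le> Re (cinner (B (x i)) (x i))"
      by auto
    define V where "V = cspan (x ` {..<k})"
    have V: "has_cdim V k"
      unfolding V_def by (rule orthonormal_has_cdim[OF x(1)])
    obtain z :: "nat \<Rightarrow> 'a" where z: "orthonormal z (Suc k)"
      using infinite_cdim_orthonormal[OF inf complex_vector.subspace_UNIV] by metis
    obtain v where v: "norm v = 1" "v \<in> ortho_compl V"
      using unit_vector_in_ortho_compl[OF V z] by auto
    have "spectral_scale B (int (Suc k)) - e < form_sup B V"
      using spectral_scale_le_form_sup[OF V z] e by linarith
    then have "\<exists>s\<in>(\<lambda>x. Re (cinner (B x) x)) ` {x \<in> ortho_compl V. norm x = 1}.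
        spectral_scale B (int (Suc k)) - e < s"
      using v by (intro less_cSupD) auto
    then obtain y where y: "y \<in> ortho_compl V" "norm y = 1"
      "spectral_scale B (int (Suc k)) - e < Re (cinner (B y) y)"
      by blast
    have "orthonormal (x(k := y)) (Suc k)"
      using y(1,2) by (intro orthonormal_extend x(1)) (auto simp: V_def ortho_compl_cspan_iff)
    moreover have "\<forall>i<Suc k. spectral_scale B (int (Suc i)) - e
        \<le> Re (cinner (B ((x(k := y)) i)) ((x(k := y)) i))"
      using x(2) y(3) by (auto simp: less_Suc_eq)
    ultimately show ?case by blast
  qed
  then show thesis using that by blast
qed

end

lemma ky_fan_lower:
  assumes B: "bounded_clinear B" and z: "orthonormal z k"
  shows "(\<Sum>n<k. spectral_scale B (- int (Suc n))) \<le> (\<Sum>i<k. Re (cinner (B (z i)) (z i)))"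
proof -
  note B' = bounded_clinear_minus[OF B]
  obtain K where "\<And>x. norm x = 1 \<Longrightarrow> \<bar>Re (cinner (- B x) x)\<bar> \<le> K"
    using form_bounded[OF B'] by metis
  from ky_fan[OF this B' z] show ?thesis
    by (simp add: spectral_scale_neg sum_negf del: of_nat_Suc)
qed

text \<open>Boundedness is what gives \<open>decr\<close> its meaning, since it is defined through a
  multiplication operator.\<close>

lemma spectral_spread_bounded:
  fixes B :: "'a::chilbert_space \<Rightarrow> 'a"
  assumes B: "bounded_clinear B" and inf: "infinite_cdim (UNIV :: 'a set)"
  obtains K where "\<And>n. \<bar>spectral_spread B n\<bar> \<le> K"
proof -
  obtain K where K: "\<And>x. norm x = 1 \<Longrightarrow> \<bar>Re (cinner (B x) x)\<bar> \<le> K"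
    using form_bounded[OF B] by metis
  then have K': "\<And>x. norm x = 1 \<Longrightarrow> \<bar>Re (cinner (- B x) x)\<bar> \<le> K" by simp
  have "\<bar>spectral_spread B n\<bar> \<le> 2 * K" for n
  proof -
    obtain z :: "nat \<Rightarrow> 'a" where z: "orthonormal z (Suc n)"
      using infinite_cdim_orthonormal[OF inf complex_vector.subspace_UNIV] by metis
    show ?thesis
      using abs_spectral_scale_le[OF K z] abs_spectral_scale_le[OF K' z]
      unfolding spectral_spread_def spectral_scale_neg by linarith
  qed
  then show thesis using that by blast
qed

lemma singular_values_bounded_decseq:
  fixes T :: "'a::chilbert_space \<Rightarrow> 'b::chilbert_space"
  assumes T: "bounded_clinear T" and inf: "infinite_cdim (UNIV :: 'a set)"
  obtains K where "\<And>n. \<bar>singular_values T n\<bar> \<le> K" "decseq (singular_values T)"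
proof -
  obtain K where K: "\<And>x. norm x = 1 \<Longrightarrow> \<bar>Re (cinner (op_abs T x) x)\<bar> \<le> K"
    using form_bounded[OF selfadjointD(1)[OF op_abs_selfadjoint[OF T]]] by metis
  have z: "\<exists>z :: nat \<Rightarrow> 'a. orthonormal z n" for n
    using infinite_cdim_orthonormal[OF inf complex_vector.subspace_UNIV] by metis
  have "\<bar>singular_values T n\<bar> \<le> K" for n
    unfolding singular_values_def using z[of "Suc n"] abs_spectral_scale_le[OF K] by blast
  moreover have "decseq (singular_values T)"
    unfolding decseq_Suc_iff singular_values_def using z spectral_scale_Suc_le[OF K] by blast
  ultimately show thesis using that by blast
qed


section \<open>Decreasing rearrangements\<close>

context
  fixes a :: "'i \<Rightarrow> real" and K :: real
  assumes bounded: "\<And>i. \<bar>a i\<bar> \<le> K"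
begin

text \<open>For bounded \<open>a\<close> the product stays square summable, so
  \<open>Abs_ell2\<close> is applied inside its proper domain.\<close>

lemma Rep_diag_op: "Rep_ell2 (diag_op a x) i = complex_of_real (a i) * Rep_ell2 x i"
proof -
  have "(\<lambda>i. (cmod (complex_of_real (a i) * Rep_ell2 x i))\<^sup>2) summable_on UNIV"
  proof (rule summable_on_comparison_test)
    show "(\<lambda>i. K\<^sup>2 * (cmod (Rep_ell2 x i))\<^sup>2) summable_on UNIV"
      by (intro summable_on_cmult_right Rep_ell2_summable)
    show "(cmod (complex_of_real (a i) * Rep_ell2 x i))\<^sup>2 \<le> K\<^sup>2 * (cmod (Rep_ell2 x i))\<^sup>2" for i
      using bounded[of i] abs_le_square_iff[of "a i" K]
      by (auto simp: norm_mult power_mult_distrib intro!: mult_right_mono)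
  qed simp
  then show ?thesis
    by (simp add: diag_op_def Abs_ell2_inverse)
qed

lemma bounded_clinear_diag_op: "bounded_clinear (diag_op a)"
proof (rule bounded_clinearI[where K = K])
  show "diag_op a (x + y) = diag_op a x + diag_op a y" for x y
    by (simp add: Rep_ell2_inject[symmetric] fun_eq_iff Rep_diag_op plus_ell2.rep_eq distrib_left)
  show "diag_op a (c *\<^sub>C x) = c *\<^sub>C diag_op a x" for c x
    by (simp add: Rep_ell2_inject[symmetric] fun_eq_iff Rep_diag_op scaleC_ell2.rep_eq)
  fix x :: "'i ell2"
  \<comment> \<open>Any index will do, and \<open>undefined\<close> names one.\<close>
  have "K \<ge> 0" using bounded[of undefined] by simp
  have "(norm (diag_op a x))\<^sup>2 \<le> (\<Sum>\<^sub>\<infinity>i. K\<^sup>2 * (cmod (Rep_ell2 x i))\<^sup>2)"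
    unfolding norm_ell2_power2
  proof (rule infsum_mono)
    show "(cmod (Rep_ell2 (diag_op a x) i))\<^sup>2 \<le> K\<^sup>2 * (cmod (Rep_ell2 x i))\<^sup>2" for i
      using bounded[of i] abs_le_square_iff[of "a i" K]
      by (auto simp: Rep_diag_op norm_mult power_mult_distrib intro!: mult_right_mono)
  qed (intro Rep_ell2_summable summable_on_cmult_right)+
  also have "\<dots> = (K * norm x)\<^sup>2"
    by (simp add: infsum_cmult_right' norm_ell2_power2 power_mult_distrib)
  finally show "norm (diag_op a x) \<le> K * norm x"
    by (rule power2_le_imp_le) (use \<open>K \<ge> 0\<close> in simp)
qed

lemma Re_diag_op:
  "Re (Rep_ell2 (diag_op a x) i * cnj (Rep_ell2 x i)) = a i * (cmod (Rep_ell2 x i))\<^sup>2"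
  unfolding cmod_power2 by (simp add: Rep_diag_op power2_eq_square algebra_simps)

lemma cinner_diag_op: "Re (cinner (diag_op a x) x) = (\<Sum>\<^sub>\<infinity>i. a i * (cmod (Rep_ell2 x i))\<^sup>2)"
proof -
  have "Re (cinner (diag_op a x) x) = (\<Sum>\<^sub>\<infinity>i. Re (Rep_ell2 (diag_op a x) i * cnj (Rep_ell2 x i)))"
    unfolding cinner_ell2.rep_eq by (rule infsum_Re[symmetric]) (rule Rep_ell2_summable_mult)
  also have "\<dots> = (\<Sum>\<^sub>\<infinity>i. a i * (cmod (Rep_ell2 x i))\<^sup>2)"
    unfolding Re_diag_op ..
  finally show ?thesis .
qed

lemma diag_op_form_summable: "(\<lambda>i. a i * (cmod (Rep_ell2 x i))\<^sup>2) summable_on UNIV"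
  using summable_on_Re[OF Rep_ell2_summable_mult[of "diag_op a x" x]] unfolding Re_diag_op .

end

section \<open>Unit vectors and one-sided bounds for rearrangements\<close>

definition ell2_unit :: "'i \<Rightarrow> 'i ell2" where
  "ell2_unit i = Abs_ell2 (\<lambda>j. if j = i then 1 else 0)"

lemma Rep_ell2_unit: "Rep_ell2 (ell2_unit i) j = (if j = i then 1 else 0)"
proof -
  have "(\<lambda>j. (cmod (if j = i then 1 else 0))\<^sup>2) summable_on UNIV \<longleftrightarrow>
      (\<lambda>j. (cmod (if j = i then 1 else 0))\<^sup>2) summable_on {i}"
    by (rule summable_on_cong_neutral) auto
  then show ?thesis
    by (simp add: ell2_unit_def Abs_ell2_inverse)
qed

lemma cinner_ell2_unit: "cinner x (ell2_unit i) = Rep_ell2 x i"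
proof -
  have "cinner x (ell2_unit i) = (\<Sum>\<^sub>\<infinity>j\<in>{i}. Rep_ell2 x j)"
    unfolding cinner_ell2.rep_eq Rep_ell2_unit by (rule infsum_cong_neutral) auto
  then show ?thesis by simp
qed

lemma orthonormal_ell2_unit: "orthonormal ell2_unit n"
  by (simp add: orthonormal_def cinner_ell2_unit Rep_ell2_unit)

text \<open>The span of the first \<open>n\<close> unit vectors is a competitor for the entry at
  \<open>n\<close>; on its complement only entries from \<open>n\<close> on occur, and these are at
  most \<open>a n\<close>.\<close>

lemma decr_le_of_decseq:
  assumes bounded: "\<And>n. \<bar>a n\<bar> \<le> K" and dec: "decseq a"
  shows "decr a n \<le> a n"
proof -
  obtain L where L: "\<And>x. norm x = 1 \<Longrightarrow> \<bar>Re (cinner (diag_op a x) x)\<bar> \<le> L"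
    by (rule form_bounded[OF bounded_clinear_diag_op[OF bounded]]) (rule that)
  define V where "V = cspan (ell2_unit ` {..<n})"
  have V: "has_cdim V n"
    unfolding V_def by (rule orthonormal_has_cdim[OF orthonormal_ell2_unit])
  have "decr a n \<le> form_sup (diag_op a) V"
    unfolding decr_def by (rule spectral_scale_le_form_sup[OF L V orthonormal_ell2_unit])
  also have "\<dots> \<le> a n"
  proof (rule cSUP_least)
    have "ell2_unit n \<in> ortho_compl V" "norm (ell2_unit n) = 1"
      by (auto simp: V_def ortho_compl_cspan_iff cinner_ell2_unit Rep_ell2_unit
          intro: orthonormal_norm[OF orthonormal_ell2_unit lessI])
    then show "{x \<in> ortho_compl V. norm x = 1} \<noteq> {}" by blast
    fix x assume "x \<in> {x \<in> ortho_compl V. norm x = 1}"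
    then have x: "norm x = 1" "\<And>i. i < n \<Longrightarrow> Rep_ell2 x i = 0"
      by (auto simp: V_def ortho_compl_cspan_iff cinner_ell2_unit)
    have "Re (cinner (diag_op a x) x) \<le> (\<Sum>\<^sub>\<infinity>i. a n * (cmod (Rep_ell2 x i))\<^sup>2)"
      unfolding cinner_diag_op[OF bounded]
    proof (rule infsum_mono)
      show "a i * (cmod (Rep_ell2 x i))\<^sup>2 \<le> a n * (cmod (Rep_ell2 x i))\<^sup>2" for i
        using x(2)[of i] decseqD[OF dec, of n i] by (cases "i < n") (simp_all add: mult_right_mono)
    next
      show "(\<lambda>i. a i * (cmod (Rep_ell2 x i))\<^sup>2) summable_on UNIV"
        by (rule diag_op_form_summable[OF bounded])
      show "(\<lambda>i. a n * (cmod (Rep_ell2 x i))\<^sup>2) summable_on UNIV"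
        by (rule summable_on_cmult_right[OF Rep_ell2_summable])
    qed
    also have "\<dots> = a n * (norm x)\<^sup>2"
      unfolding infsum_cmult_right' norm_ell2_power2 ..
    finally show "Re (cinner (diag_op a x) x) \<le> a n"
      by (simp add: x(1))
  qed
  finally show ?thesis .
qed

text \<open>Ky Fan's inequality for the multiplication operator, tested on the first
  \<open>k\<close> unit vectors.\<close>

lemma sum_le_sum_decr:
  fixes b :: "nat \<Rightarrow> real"
  assumes bounded: "\<And>n. \<bar>b n\<bar> \<le> K"
  shows "(\<Sum>n<k. b n) \<le> (\<Sum>n<k. decr b n)"
proof -
  obtain L where "\<And>x. norm x = 1 \<Longrightarrow> \<bar>Re (cinner (diag_op b x) x)\<bar> \<le> L"
    by (rule form_bounded[OF bounded_clinear_diag_op[OF bounded]]) (rule that)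
  from ky_fan[OF this bounded_clinear_diag_op[OF bounded] orthonormal_ell2_unit]
  show ?thesis
    by (simp add: decr_def cinner_ell2_unit Rep_diag_op[OF bounded] Rep_ell2_unit)
qed

section \<open>The main inequality\<close>

text \<open>Compressing \<open>K\<close> to the span of the \<open>x i\<close> by the projection \<open>Q\<close> makes the defect operator,
  the square root of \<open>1 - Q K\<^sup>* K Q\<close>, commute with \<open>Q\<close>, so that its values on the \<open>x i\<close> stay
  in a \<open>k\<close>-dimensional space and can be transported to the span of the \<open>g i\<close>.\<close>

lemma contraction_defect_vectors:
  fixes K :: "'a::chilbert_space \<Rightarrow> 'c::chilbert_space" and g :: "nat \<Rightarrow> 'b::complex_inner"
  assumes K: "bounded_clinear K" and contr: "\<And>x. norm (K x) \<le> norm x"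
    and x: "orthonormal x k" and g: "orthonormal g k"
  obtains r where "\<And>i. r i \<in> cspan (g ` {..<k})"
    "\<And>i j. i < k \<Longrightarrow> j < k \<Longrightarrow>
      cinner (r i) (r j) = (if i = j then 1 else 0) - cinner (K (x i)) (K (x j))"
proof -
  define Q where "Q v = (\<Sum>j<k. cinner v (x j) *\<^sub>C x j)" for v
  have Q_x: "Q (x i) = x i" if "i < k" for i
    unfolding Q_def
    by (rule orthonormal_expansion[OF x, symmetric]) (use that in \<open>blast intro: complex_vector.span_base\<close>)
  have Q_sym: "cinner (Q u) v = cinner u (Q v)" for u v
    unfolding Q_def cinner_sum_left cinner_sum_right
    by (intro sum.cong) (auto simp: cinner_simps mult.commute cinner_commute[symmetric])
  have Q_idem: "Q (Q v) = Q v" for v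
    unfolding Q_def[of "Q v"]
    using orthonormal_expansion[OF x, of "Q v"] sum_scaleC_in_cspan[of "\<lambda>j. cinner v (x j)" x "{..<k}"]
    by (simp add: Q_def[of v])
  have Q_le: "norm (Q v) \<le> norm v" for v
  proof -
    have "(norm (Q v))\<^sup>2 = Re (cinner v (Q v))"
      using Q_sym[of v "Q v"] Q_idem by (metis Re_cinner_self)
    also have "\<dots> \<le> norm v * norm (Q v)"
      using Re_cinner_le by (rule abs_le_D1)
    finally show ?thesis
      by (cases "Q v = 0") (auto simp: power2_eq_square)
  qed
  have Q: "bounded_clinear Q"
    by (rule bounded_clinearI[where K = 1])
      (simp_all add: Q_le, simp_all add: Q_def cinner_simps scaleC_add_left sum.distrib
        complex_vector.scale_sum_right scaleC_scaleC)
  define M where "M v = K (Q v)" for v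
  have M: "bounded_clinear M"
    unfolding M_def by (rule bounded_clinear_compose[OF K Q])
  have M_le: "norm (M v) \<le> 1 * norm v" for v
    unfolding M_def using contr[of "Q v"] Q_le[of v] by simp
  define G where "G v = cadjoint M (M v)" for v
  have G: "selfadjoint G"
    unfolding G_def
    by (intro selfadjointI bounded_clinear_compose[OF bounded_clinear_cadjoint] M)
      (simp add: cinner_cadjoint[OF M, symmetric] cinner_cadjoint_left[OF M])
  have G_le: "norm (G v) \<le> norm v" for v
    unfolding G_def using norm_cadjoint_le[OF M _ M_le, of "M v"] M_le[of v] by simp
  \<comment> \<open>Both sides, paired with \<open>u\<close>, give <M u, M v>, because
    \<open>M\<close> absorbs \<open>Q\<close>.\<close>
  have Q_G: "Q (G v) = G (Q v)" for v
  proof -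
    have "M (Q v) = M v" for v by (simp add: M_def Q_idem)
    then have "cinner u (Q (G v)) = cinner u (G (Q v))" for u
      by (simp add: Q_sym[symmetric] G_def cinner_cadjoint[OF M, symmetric])
    then show ?thesis by (rule cinner_ext_right)
  qed
  obtain D where D: "positive_op D" "\<And>v. D (D v) = v - G v"
    "\<And>F v. bounded_linear F \<Longrightarrow> (\<And>v. F (G v) = G (F v)) \<Longrightarrow> F (D v) = D (F v)"
    using sqrt_one_minus_contraction[OF G G_le] by metis
  have D_sym: "cinner (D u) v = cinner u (D v)" for u v
    using D(1) selfadjointD(2) by (auto simp: positive_op_def)
  have D_x: "D (x i) = (\<Sum>j<k. cinner (D (x i)) (x j) *\<^sub>C x j)" if "i < k" for i
    using D(3)[of Q "x i", OF bounded_clinearD(8)[OF Q] Q_G] Q_x[OF that] by (simp add: Q_def)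
  \<comment> \<open>Same coordinates as \<open>D (x i)\<close>, but in the family \<open>g\<close>:
    the Gram matrix is unchanged.\<close>
  define r where "r i = (\<Sum>j<k. cinner (D (x i)) (x j) *\<^sub>C g j)" for i
  show thesis
  proof (rule that[of r])
    show "r i \<in> cspan (g ` {..<k})" for i
      unfolding r_def by (rule sum_scaleC_in_cspan)
    fix i j assume ij: "i < k" "j < k"
    have "cinner (r i) (r j) = cinner (D (x i)) (D (x j))"
      unfolding r_def orthonormal_parseval[OF g]
      using orthonormal_parseval[OF x, of "\<lambda>l. cinner (D (x i)) (x l)" "\<lambda>l. cinner (D (x j)) (x l)"]
      unfolding D_x[OF ij(1), symmetric] D_x[OF ij(2), symmetric] ..
    also have "\<dots> = cinner (D (D (x i))) (x j)"
      by (simp add: D_sym)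
    also have "\<dots> = cinner (x i) (x j) - cinner (K (x i)) (K (x j))"
      by (simp add: D(2) G_def cinner_simps cinner_cadjoint_left[OF M] M_def Q_x ij)
    finally show "cinner (r i) (r j) = (if i = j then 1 else 0) - cinner (K (x i)) (K (x j))"
      by (simp add: orthonormalD[OF x ij])
  qed
qed

text \<open>The column with entries \<open>C\<close> and \<open>S\<close> is a partial isometry with
  initial projection \<open>P\<close>, whence the name.\<close>

locale column_partial_isometry =
  fixes C S E P :: "'a::chilbert_space \<Rightarrow> 'a"
  assumes C: "bounded_clinear C" and S: "bounded_clinear S"
    and sum_eq: "\<And>x. cadjoint C (C x) + cadjoint S (S x) = P x"
    and idem: "\<And>x. P (P x) = P x"
    and E: "selfadjoint E"
begin

lemma cinner_P: "cinner (P x) y = cinner (C x) (C y) + cinner (S x) (S y)"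
  by (simp add: sum_eq[symmetric] cinner_simps cinner_cadjoint_left[OF C] cinner_cadjoint_left[OF S])

text \<open>The form of \<open>P\<close> is Hermitian by \<open>cinner_P\<close>; with
  \<open>idem\<close> this makes \<open>P\<close> an orthogonal projection.\<close>

lemma P_sym: "cinner (P x) y = cinner x (P y)"
  using cinner_P[of x y] cinner_P[of y x] by (metis cinner_commute complex_cnj_add)

lemma P: "bounded_clinear P"
  unfolding sum_eq[symmetric]
  by (intro bounded_clinear_add bounded_clinear_compose[OF bounded_clinear_cadjoint] C S)

text \<open>On the range of 1 - P the form of \<open>P\<close> vanishes, and it is the sum of the
  squared norms of the images under \<open>C\<close> and \<open>S\<close>.\<close>

lemma C_P: "C (P x) = C x" and S_P: "S (P x) = S x"
proof -
  define y where "y = x - P x"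
  have "P y = 0"
    by (simp add: y_def bounded_clinearD[OF P] idem)
  then have "cinner (C y) (C y) + cinner (S y) (S y) = 0"
    using cinner_P[of y y] by simp
  then have "(norm (C y))\<^sup>2 + (norm (S y))\<^sup>2 = 0"
    by (simp add: cinner_self flip: of_real_add of_real_power)
  then have "C y = 0" "S y = 0"
    by (auto simp: add_nonneg_eq_0_iff)
  then show "C (P x) = C x" "S (P x) = S x"
    by (simp_all add: y_def bounded_clinearD[OF C] bounded_clinearD[OF S])
qed

lemma P_cadjoint: "P (cadjoint C x) = cadjoint C x" "P (cadjoint S x) = cadjoint S x"
  by (rule cinner_ext_right,
      simp add: P_sym[symmetric] cinner_cadjoint[OF C, symmetric] cinner_cadjoint[OF S, symmetric] C_P S_P)+

text \<open>The vector \<open>h\<close> lies in the range of \<open>P\<close>, where the column is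
  isometric; Cauchy-Schwarz for the pairing of its image with \<open>(a, b)\<close> gives the
  bound.\<close>

lemma row_contraction: "(norm (cadjoint C a + cadjoint S b))\<^sup>2 \<le> (norm a)\<^sup>2 + (norm b)\<^sup>2"
proof -
  define h where "h = cadjoint C a + cadjoint S b"
  have "P h = h"
    by (simp add: h_def bounded_clinearD[OF P] P_cadjoint)
  then have h: "(norm (C h, S h))\<^sup>2 = (norm h)\<^sup>2"
    using arg_cong[OF cinner_P[of h h], of Re] by (simp add: norm_Pair)
  have "(norm h)\<^sup>2 = Re (cinner h (cadjoint C a + cadjoint S b))"
    by (simp add: h_def[symmetric])
  also have "\<dots> = Re (cinner (C h, S h) (a, b))"
    by (simp add: cinner_prod_def cinner_simps cinner_cadjoint[OF C, symmetric]
        cinner_cadjoint[OF S, symmetric])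
  also have "\<dots> \<le> norm (C h, S h) * norm (a, b)"
    using Re_cinner_le by (rule abs_le_D1)
  also have "\<dots> = norm h * norm (a, b)"
    using h by (simp add: power2_eq_iff_nonneg)
  finally have "norm h \<le> norm (a, b)"
    by (cases "h = 0") (auto simp: power2_eq_square)
  then have "(norm h)\<^sup>2 \<le> (norm (a, b))\<^sup>2"
    by (intro power_mono) auto
  then show ?thesis
    by (simp add: h_def norm_Pair)
qed

lemma compression_selfadjoint: "selfadjoint (P \<circ> E \<circ> P)"
  unfolding o_def
  by (intro selfadjointI bounded_clinear_compose[OF P] bounded_clinear_compose[OF selfadjointD(1)[OF E]] P)
    (simp add: P_sym selfadjointD(2)[OF E])

lemma T: "bounded_clinear (S \<circ> E \<circ> cadjoint C)"
  unfolding o_def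
  by (intro bounded_clinear_compose[OF S] bounded_clinear_compose[OF selfadjointD(1)[OF E]]
      bounded_clinear_cadjoint C)

text \<open>\<open>B\<close> stands for \<open>PEP \<oplus> 0\<close> or for \<open>PEP\<close> itself; the \<open>g i\<close> give room in its kernel.\<close>

lemma sum_singular_values_le:
  fixes B :: "'b::chilbert_space \<Rightarrow> 'b" and \<iota> :: "'a \<Rightarrow> 'b"
  assumes inf: "infinite_cdim (UNIV :: 'a set)"
    and B: "bounded_clinear B"
    and \<iota>: "\<And>x y. cinner (\<iota> x) (\<iota> y) = cinner x y" "\<And>x. B (\<iota> x) = \<iota> (P (E (P x)))"
    and g: "orthonormal g k" "\<And>i. i < k \<Longrightarrow> B (g i) = 0" "\<And>i x. i < k \<Longrightarrow> cinner (\<iota> (P x)) (g i) = 0"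
  shows "(\<Sum>n<k. 2 * singular_values (S \<circ> E \<circ> cadjoint C) n) \<le> (\<Sum>n<k. spectral_spread B n)"
proof (rule field_le_epsilon)
  fix e :: real assume "e > 0"
  define T where "T = S \<circ> E \<circ> cadjoint C"
  note T' = T[folded T_def]
  \<comment> \<open>The nearly attained scale and the approximate polar factor each cost
    \<open>d\<close>; after doubling this is \<open>4 * d\<close> per index. \<open>Suc k\<close>
    keeps the divisor positive for k = 0.\<close>
  define d where "d = e / (4 * real (Suc k))"
  have d: "d > 0" "4 * real k * d \<le> e"
    using \<open>e > 0\<close> by (simp_all add: d_def field_simps)
  obtain L where "\<And>x. norm x = 1 \<Longrightarrow> \<bar>Re (cinner (op_abs T x) x)\<bar> \<le> L"
    by (rule form_bounded[OF selfadjointD(1)[OF op_abs_selfadjoint[OF T']]]) (rule that)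
  from spectral_scale_nearly_attained[OF this inf d(1), of k]
  obtain x where x: "orthonormal x k"
    "\<And>i. i < k \<Longrightarrow> singular_values T i - d \<le> Re (cinner (op_abs T (x i)) (x i))"
    unfolding singular_values_def by blast
  obtain U where U: "bounded_clinear U" "\<And>x. norm (U x) \<le> norm x"
    "\<And>x. Re (cinner (op_abs T x) x) - d * (norm x)\<^sup>2 \<le> Re (cinner (T x) (U x))"
    using approximate_polar[OF T' d(1)] by metis
  \<comment> \<open>The factor \<open>1 / sqrt 2\<close> compensates that
    \<open>row_contraction\<close>, applied to \<open>v\<close> and a vector of norm at most
    \<open>norm v\<close>, yields \<open>2 * (norm v)\<^sup>2\<close>.\<close>
  define K where "K s v = complex_of_real (1 / sqrt 2) *\<^sub>C (cadjoint C v + cadjoint S (complex_of_real s *\<^sub>C U v))"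
    for s v
  have K_clin: "bounded_clinear (K s)" for s
    unfolding K_def
    by (intro bounded_clinear_scaleC bounded_clinear_add bounded_clinear_cadjoint C
        bounded_clinear_compose[OF bounded_clinear_cadjoint[OF S]] U)
  have K_le: "norm (K s v) \<le> norm v" if "\<bar>s\<bar> = 1" for s v
  proof -
    have "(norm (complex_of_real s *\<^sub>C U v))\<^sup>2 \<le> (norm v)\<^sup>2"
      using U(2)[of v] that by (intro power_mono) (simp_all add: norm_scaleC)
    then have "(norm (cadjoint C v + cadjoint S (complex_of_real s *\<^sub>C U v)))\<^sup>2 \<le> 2 * (norm v)\<^sup>2"
      using row_contraction[of v "complex_of_real s *\<^sub>C U v"] by linarith
    then have "(norm (K s v))\<^sup>2 \<le> (norm v)\<^sup>2"
      by (simp add: K_def norm_scaleC norm_divide power_mult_distrib power_divide)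
    then show ?thesis
      by (rule power2_le_imp_le) simp
  qed
  have PK: "P (K s v) = K s v" for s v
    by (simp add: K_def bounded_clinearD[OF P] P_cadjoint)
  \<comment> \<open>For a self-adjoint form the values at a + b and a - b differ by 4 Re <E a, b>;
    the normalization halves this.\<close>
  have polarization: "2 * Re (cinner (T v) (U v)) =
      Re (cinner (E (K 1 v)) (K 1 v)) - Re (cinner (E (K (-1) v)) (K (-1) v))" for v
  proof -
    define a b where "a = cadjoint C v" and "b = cadjoint S (U v)"
    have K': "K 1 v = (1 / sqrt 2) *\<^sub>R (a + b)" "K (-1) v = (1 / sqrt 2) *\<^sub>R (a - b)"
      by (simp_all add: K_def a_def b_def scaleR_scaleC scaleC_one complex_vector.scale_minus_left
          bounded_clinearD[OF bounded_clinear_cadjoint[OF S]])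
    have "cinner (T v) (U v) = cinner (E a) b"
      by (simp add: T_def a_def b_def cinner_cadjoint[OF S])
    moreover have "Re (cinner (E b) a) = Re (cinner (E a) b)"
      using selfadjointD(2)[OF E, of b a] cinner_commute[of b "E a"] by simp
    ultimately show ?thesis
      unfolding K' by (simp add: bounded_clinearD[OF selfadjointD(1)[OF E]] cinner_simps algebra_simps
          flip: of_real_mult)
  qed
  have "\<exists>z. orthonormal z k \<and>
      (\<forall>i<k. Re (cinner (B (z i)) (z i)) = Re (cinner (E (K s (x i))) (K s (x i))))"
    if s: "\<bar>s\<bar> = 1" for s
  proof -
    obtain r where r: "\<And>i. r i \<in> cspan (g ` {..<k})"
      "\<And>i j. i < k \<Longrightarrow> j < k \<Longrightarrow>
        cinner (r i) (r j) = (if i = j then 1 else 0) - cinner (K s (x i)) (K s (x j))"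
      using contraction_defect_vectors[OF K_clin K_le[OF s] x(1) g(1)] by metis
    have r_expand: "r i = (\<Sum>j<k. cinner (r i) (g j) *\<^sub>C g j)" for i
      by (rule orthonormal_expansion[OF g(1) r(1)])
    have Br: "B (r i) = 0" for i
      by (subst r_expand) (simp add: bounded_clinearD[OF B] g(2))
    have orth: "cinner (\<iota> (P v)) (r i) = 0" for v i
      by (subst r_expand) (simp add: cinner_sum_right cinner_simps g(3))
    then have orth': "cinner (r i) (\<iota> (P v)) = 0" for v i
      using cinner_commute[of "r i" "\<iota> (P v)"] by simp
    \<comment> \<open>The Gram matrix of the \<open>r i\<close> completes that of the images to the
      identity. \<open>B\<close> kills \<open>r i\<close>, which is also orthogonal to the image of
      the range of \<open>P\<close>, so the form values stay as they were.\<close>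
    define z where "z i = \<iota> (P (K s (x i))) + r i" for i
    have orthK: "cinner (\<iota> (K s (x i))) (r j) = 0" "cinner (r j) (\<iota> (K s (x i))) = 0" for i j
      using orth[of "K s (x i)" j] orth'[of j "K s (x i)"] unfolding PK .
    have "orthonormal z k"
      unfolding orthonormal_def by (auto simp: z_def cinner_simps \<iota>(1) r(2) PK orthK)
    moreover have "Re (cinner (B (z i)) (z i)) = Re (cinner (E (K s (x i))) (K s (x i)))" for i
    proof -
      have "cinner (B (z i)) (z i) = cinner (P (E (K s (x i)))) (K s (x i))"
        by (simp add: z_def bounded_clinearD[OF B] Br \<iota> idem cinner_simps orth PK)
      then show ?thesis
        by (simp add: P_sym PK)
    qed
    ultimately show ?thesis by blast
  qed
  from this[of 1] this[of "-1"] obtain z1 z2 where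
    z1: "orthonormal z1 k" "\<And>i. i < k \<Longrightarrow> Re (cinner (B (z1 i)) (z1 i)) = Re (cinner (E (K 1 (x i))) (K 1 (x i)))"
    and z2: "orthonormal z2 k" "\<And>i. i < k \<Longrightarrow> Re (cinner (B (z2 i)) (z2 i)) = Re (cinner (E (K (-1) (x i))) (K (-1) (x i)))"
    by auto
  obtain M where M: "\<And>x. norm x = 1 \<Longrightarrow> \<bar>Re (cinner (B x) x)\<bar> \<le> M"
    by (rule form_bounded[OF B]) (rule that)
  have "(\<Sum>n<k. 2 * singular_values T n) \<le> (\<Sum>i<k. 2 * Re (cinner (T (x i)) (U (x i))) + 4 * d)"
  proof (rule sum_mono)
    fix i assume "i \<in> {..<k}"
    then show "2 * singular_values T i \<le> 2 * Re (cinner (T (x i)) (U (x i))) + 4 * d"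
      using x(2)[of i] U(3)[of "x i"] orthonormal_norm[OF x(1), of i] by simp
  qed
  also have "\<dots> = (\<Sum>i<k. Re (cinner (B (z1 i)) (z1 i))) - (\<Sum>i<k. Re (cinner (B (z2 i)) (z2 i)))
      + 4 * real k * d"
    by (simp add: sum.distrib polarization z1(2) z2(2) flip: sum_subtractf)
  also have "\<dots> \<le> (\<Sum>n<k. spectral_scale B (int (Suc n))) - (\<Sum>n<k. spectral_scale B (- int (Suc n))) + e"
    using ky_fan[OF M B z1(1)] ky_fan_lower[OF B z2(1)] d(2) by linarith
  also have "\<dots> = (\<Sum>n<k. spectral_spread B n) + e"
    by (simp add: spectral_spread_def sum_subtractf)
  finally show "(\<Sum>n<k. 2 * singular_values (S \<circ> E \<circ> cadjoint C) n) \<le> (\<Sum>n<k. spectral_spread B n) + e"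
    unfolding T_def .
qed

text \<open>Passes from plain partial sums to rearranged ones: the left sequence is decreasing, and
  rearrangement can only raise partial sums on the right.\<close>

lemma submajorized_spectral_spread:
  fixes B :: "'b::chilbert_space \<Rightarrow> 'b" and \<iota> :: "'a \<Rightarrow> 'b"
  assumes inf: "infinite_cdim (UNIV :: 'a set)" "infinite_cdim (UNIV :: 'b set)"
    and B: "bounded_clinear B"
    and \<iota>: "\<And>x y. cinner (\<iota> x) (\<iota> y) = cinner x y" "\<And>x. B (\<iota> x) = \<iota> (P (E (P x)))"
    and g: "\<And>k. \<exists>g. orthonormal g k \<and> (\<forall>i<k. B (g i) = 0 \<and> (\<forall>x. cinner (\<iota> (P x)) (g i) = 0))"
  shows "(\<lambda>n. 2 * singular_values (S \<circ> E \<circ> cadjoint C) n) \<prec>\<^sub>w spectral_spread B"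
  unfolding submajorized_def
proof
  fix k
  obtain L where L: "\<And>n. \<bar>singular_values (S \<circ> E \<circ> cadjoint C) n\<bar> \<le> L"
    "decseq (singular_values (S \<circ> E \<circ> cadjoint C))"
    by (rule singular_values_bounded_decseq[OF T inf(1)]) (rule that)
  have "decr (\<lambda>n. 2 * singular_values (S \<circ> E \<circ> cadjoint C) n) n \<le>
      2 * singular_values (S \<circ> E \<circ> cadjoint C) n" for n
    by (rule decr_le_of_decseq[where K = "2 * L"])
      (use L in \<open>auto simp: abs_mult decseq_def\<close>)
  then have "(\<Sum>n<k. decr (\<lambda>n. 2 * singular_values (S \<circ> E \<circ> cadjoint C) n) n) \<le>
      (\<Sum>n<k. 2 * singular_values (S \<circ> E \<circ> cadjoint C) n)"
    by (rule sum_mono)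
  also have "\<dots> \<le> (\<Sum>n<k. spectral_spread B n)"
    using sum_singular_values_le[OF inf(1) B \<iota>] g[of k] by blast
  also obtain M where "\<And>n. \<bar>spectral_spread B n\<bar> \<le> M"
    by (rule spectral_spread_bounded[OF B inf(2)]) (rule that)
  from sum_le_sum_decr[OF this] have "(\<Sum>n<k. spectral_spread B n) \<le> (\<Sum>n<k. decr (spectral_spread B) n)" .
  finally show "(\<Sum>n<k. decr (\<lambda>n. 2 * singular_values (S \<circ> E \<circ> cadjoint C) n) n) \<le>
      (\<Sum>n<k. decr (spectral_spread B) n)" .
qed

end

section \<open>Infinite dimension of the direct sum, and the two cases of the theorem\<close>

lemma has_cdim_orthonormal_le:
  assumes "has_cdim (UNIV :: 'a::complex_inner set) n" "orthonormal (z :: nat \<Rightarrow> 'a) m"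
  shows "m \<le> n"
proof (rule ccontr)
  assume "\<not> m \<le> n"
  then obtain x :: 'a where x: "norm x = 1" "x \<in> ortho_compl UNIV"
    using unit_vector_in_ortho_compl[OF assms] by auto
  then have "cinner x x = 0" by (simp add: ortho_compl_def)
  then show False using cinner_unit[OF x(1)] by simp
qed

text \<open>Arbitrarily long orthonormal families of the second factor survive in the
  product.\<close>

lemma infinite_cdim_prod:
  assumes "infinite_cdim (UNIV :: 'b::complex_inner set)"
  shows "infinite_cdim (UNIV :: ('a::complex_inner \<times> 'b) set)"
  unfolding infinite_cdim_def
proof (intro allI notI)
  fix n assume n: "has_cdim (UNIV :: ('a \<times> 'b) set) n"
  obtain y :: "nat \<Rightarrow> 'b" where "orthonormal y (Suc n)"
    using infinite_cdim_orthonormal[OF assms complex_vector.subspace_UNIV] by metis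
  then have "orthonormal (\<lambda>i. (0 :: 'a, y i)) (Suc n)"
    by (simp add: orthonormal_def cinner_prod_def)
  from has_cdim_orthonormal_le[OF n this] show False by simp
qed

theorem proposition5p2:
  fixes C S E P :: "'a::chilbert_space \<Rightarrow> 'a"
  assumes "infinite_cdim (UNIV :: 'a set)"
    and "separable_space (euclidean :: 'a topology)"
    and "bounded_clinear C" and "bounded_clinear S"
    and "(\<lambda>x. cadjoint C (C x) + cadjoint S (S x)) = P"
    and "P = P \<circ> P"
    and "selfadjoint E"
  shows "(\<lambda>n. 2 * singular_values (S \<circ> E \<circ> cadjoint C) n)
           \<prec>\<^sub>w spectral_spread (block_diag (P \<circ> E \<circ> P) (\<lambda>_::'a. 0::'a)) \<and>
         (infinite_cdim (op_kernel P) \<longrightarrow>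
           (\<lambda>n. 2 * singular_values (S \<circ> E \<circ> cadjoint C) n)
             \<prec>\<^sub>w spectral_spread (P \<circ> E \<circ> P))"
proof (intro conjI impI)
  interpret column_partial_isometry C S E P
  proof
    show "cadjoint C (C x) + cadjoint S (S x) = P x" for x
      using assms(5) by (rule fun_cong)
    show "P (P x) = P x" for x
      using fun_cong[OF assms(6), of x] unfolding comp_apply by (rule sym)
  qed (fact assms)+
  note A = selfadjointD(1)[OF compression_selfadjoint]
  obtain L where L: "L > 0" "\<And>x. norm ((P \<circ> E \<circ> P) x) \<le> L * norm x"
    using bounded_clinear_bound[OF A] by metis
  show "(\<lambda>n. 2 * singular_values (S \<circ> E \<circ> cadjoint C) n)
           \<prec>\<^sub>w spectral_spread (block_diag (P \<circ> E \<circ> P) (\<lambda>_::'a. 0::'a))"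
  proof (rule submajorized_spectral_spread[where \<iota> = "\<lambda>x. (x, 0)"])
    show "bounded_clinear (block_diag (P \<circ> E \<circ> P) (\<lambda>_::'a. 0::'a))"
    proof (rule bounded_clinearI[where K = L])
      fix x :: "'a \<times> 'a"
      have "norm (block_diag (P \<circ> E \<circ> P) (\<lambda>_::'a. 0::'a) x) = norm ((P \<circ> E \<circ> P) (fst x))"
        by (simp add: block_diag_def case_prod_unfold norm_Pair)
      also have "\<dots> \<le> L * norm (fst x)" by (rule L)
      also have "\<dots> \<le> L * norm x"
        using L(1) norm_fst_le[of "fst x" "snd x"] by (intro mult_left_mono) simp_all
      finally show "norm (block_diag (P \<circ> E \<circ> P) (\<lambda>_::'a. 0::'a) x) \<le> L * norm x" .
    qed (simp_all add: block_diag_def case_prod_unfold scaleC_prod_def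
        bounded_clinearD[OF P] bounded_clinearD[OF selfadjointD(1)[OF E]])
    fix k
    \<comment> \<open>The second summand supplies the room: the block operator vanishes there, and
      it is orthogonal to the embedded first summand.\<close>
    obtain y :: "nat \<Rightarrow> 'a" where "orthonormal y k"
      using infinite_cdim_orthonormal[OF assms(1) complex_vector.subspace_UNIV] by metis
    then show "\<exists>g. orthonormal g k \<and> (\<forall>i<k. block_diag (P \<circ> E \<circ> P) (\<lambda>_::'a. 0::'a) (g i) = 0 \<and>
        (\<forall>x. cinner (P x, 0) (g i) = 0))"
      by (intro exI[of _ "\<lambda>i. (0, y i)"])
        (auto simp: orthonormal_def cinner_prod_def block_diag_def zero_prod_def
          bounded_clinearD[OF P] bounded_clinearD[OF selfadjointD(1)[OF E]])
  qed (use assms(1) in \<open>auto simp: block_diag_def cinner_prod_def intro: infinite_cdim_prod\<close>)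
  assume ker: "infinite_cdim (op_kernel P)"
  have ker_subspace: "complex_vector.subspace (op_kernel P)"
    by (rule complex_vector.subspaceI) (auto simp: op_kernel_def bounded_clinearD[OF P])
  show "(\<lambda>n. 2 * singular_values (S \<circ> E \<circ> cadjoint C) n) \<prec>\<^sub>w spectral_spread (P \<circ> E \<circ> P)"
  proof (rule submajorized_spectral_spread[where \<iota> = "\<lambda>x. x"])
    fix k
    \<comment> \<open>Here the room is the kernel itself, orthogonal to the range of
      \<open>P\<close> by \<open>P_sym\<close>.\<close>
    obtain g where g: "orthonormal g k" "\<And>i. i < k \<Longrightarrow> P (g i) = 0"
      by (rule infinite_cdim_orthonormal[OF ker ker_subspace]) (use that in \<open>auto simp: op_kernel_def\<close>)
    then show "\<exists>g. orthonormal g k \<and> (\<forall>i<k. (P \<circ> E \<circ> P) (g i) = 0 \<and> (\<forall>x. cinner (P x) (g i) = 0))"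
      by (intro exI[of _ g]) (simp add: P_sym bounded_clinearD[OF P] bounded_clinearD[OF selfadjointD(1)[OF E]])
  qed (use assms(1) A in auto)
qed

end
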